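(* Let $\Lambda\subseteq\mathbb{C}^2$ be a discrete lattice, let $p_1,\ldots,p_m\in\mathbb{C}^2$, let $\Lambda_0=\bigcup_{j=1}^m(\Lambda+p_j)$, and for $r>0$ let $\Lambda_{0,r}=\bigcup_{p\in\Lambda_0}\Delta^2(p;r)$. Then for some $r>0$ there exists an injective holomorphic map $F:\mathbb{C}^2\to\mathbb{C}^2\setminus\Lambda_{0,r}$.
   Context: A lattice is a discrete $\mathbb{Z}$-submodule (discrete additive subgroup) of $\mathbb{C}^2$, and $\Lambda+p$ denotes the translate of $\Lambda$ by $p$. $\Delta^2(p;r)$ is the open bidisk with center $p$ and radius $r$ in both coordinate directions, i.e. $\{(z,w): |z-p^{(1)}|<r,\ |w-p^{(2)}|<r\}$ for $p=(p^{(1)},p^{(2)})$. *)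

theory Defs
  imports "HOL-Analysis.Analysis"
begin

(* No condition on the rank: the trivial group and lattices of rank 1, 2, 3, 4 are all included. *)
definition is_lattice :: "(complex^2) set \<Rightarrow> bool" where
  "is_lattice L \<longleftrightarrow>
     0 \<in> L \<and> (\<forall>x\<in>L. \<forall>y\<in>L. x + y \<in> L) \<and> (\<forall>x\<in>L. - x \<in> L) \<and> discrete L"

definition bidisk :: "complex^2 \<Rightarrow> real \<Rightarrow> (complex^2) set" where
  "bidisk p r = {x. cmod (x $ 1 - p $ 1) < r \<and> cmod (x $ 2 - p $ 2) < r}"

(* The library's holomorphic_on covers one complex variable only. A map of several variables is
   holomorphic if its real Frechet derivative exists at every point and is complex linear;
   ( *s) is scalar multiplication by complex numbers, whereas has_derivative by itself only
   demands real linearity. *)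
definition entire_map :: "(complex^'n \<Rightarrow> complex^'m) \<Rightarrow> bool" where
  "entire_map F \<longleftrightarrow>
     (\<forall>x. \<exists>D. Vector_Spaces.linear (*s) (*s) D \<and> (F has_derivative D) (at x))"

end

theory Submission
  imports Defs
begin

text \<open>In suitable complex coordinates $(z, w)$ both $z$ and $w$ have integral imaginary part on the
  lattice. On the resulting horizontal strips the entire function $H(z) = -z^2 + \cosh(2 \pi N z)$,
  with $N$ from simultaneous Diophantine approximation, satisfies $\mathrm{Re} H(z) \ge |z|^2$. So,
  after shifting $w$ away from zero, the overshear $(z, w) \mapsto (z, C w e^{H(z)})$ carries all the
  bidisks into the cone $|w| \ge \max(10, |z|)$. This cone is forward invariant under a Henon-type
  automorphism whose derivative at the fixed point $0$ is half the identity. The entire solution of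
  $F(2x) = g(F(x))$, where $g$ is the inverse automorphism, is injective with range in the basin of
  attraction of $0$, hence misses the cone; composing it with the inverse of the overshear gives the
  theorem.\<close>

subsection \<open>Poincare maps at a repelling fixed point\<close>

text \<open>The obstacle is that infinitely many bidisks, spread in every direction when the rank is
  4, have to be controlled by one entire function of one variable. Integrality gives the control: on
  the bidisks both imaginary parts lie, up to a small error, in finitely many cosets of the
  integers. For w this leaves a horizontal line free, and moving that line to the real axis bounds
  |w| from below. For z = x + iy, the term -z^2 has real part y^2 - x^2, and Re cosh(tz) = cosh(tx)
  cos(ty) repairs the loss in x wherever cos(ty) is bounded below; approximating the finitely many
  offsets by rationals with one denominator achieves that with a single t. The radius comes last, as
  it depends on N and on the gap around the free line. The automorphism has a scalar linear part, so
  no resonances arise: exchanging one doubling for one step of g at scale 2^-n costs O(4^-n), and n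
  further steps amplify this only to O(2^-n). Hence g^n(x / 2^n) converges without any normal
  form.\<close>

lemma has_derivative_vec_componentwise:
  fixes F :: "'a::real_normed_vector \<Rightarrow> ('b::euclidean_space)^'n"
  assumes "\<And>i. ((\<lambda>x. F x $ i) has_derivative (\<lambda>v. D v $ i)) (at a)"
  shows "(F has_derivative D) (at a)"
proof -
  have "((\<lambda>x. F x \<bullet> b) has_derivative (\<lambda>v. D v \<bullet> b)) (at a)" if "b \<in> Basis" for b
  proof -
    obtain i u where "b = axis i u"
      using \<open>b \<in> Basis\<close> unfolding Basis_vec_def by blast
    then show ?thesis
      using has_derivative_inner_left[OF assms[of i]] by (simp add: inner_axis)
  qed
  then show ?thesis
    by (subst has_derivative_componentwise_within) auto
qed

lemma linear_vec_iff:
  fixes D :: "complex^'n \<Rightarrow> complex^'m"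
  shows "Vector_Spaces.linear (*s) (*s) D \<longleftrightarrow>
    (\<forall>x y. D (x + y) = D x + D y) \<and> (\<forall>c x. D (c *s x) = c *s D x)"
  by (simp add: Vector_Spaces.linear_iff vec.vector_space_axioms)

lemma entire_map_id: "entire_map (\<lambda>x. x)"
  unfolding entire_map_def linear_vec_iff
  by (intro allI exI[of _ "\<lambda>v. v"]) auto

lemma entire_map_compose:
  assumes "entire_map F" "entire_map G"
  shows "entire_map (\<lambda>x. F (G x))"
  unfolding entire_map_def
proof
  fix x
  obtain D where D: "Vector_Spaces.linear (*s) (*s) D" "(G has_derivative D) (at x)"
    using assms(2) unfolding entire_map_def by blast
  obtain E where E: "Vector_Spaces.linear (*s) (*s) E" "(F has_derivative E) (at (G x))"
    using assms(1) unfolding entire_map_def by blast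
  have "((\<lambda>x. F (G x)) has_derivative (\<lambda>v. E (D v))) (at x)"
    using has_derivative_compose[OF D(2) E(2)] .
  moreover have "Vector_Spaces.linear (*s) (*s) (\<lambda>v. E (D v))"
    using D(1) E(1) by (simp add: linear_vec_iff)
  ultimately show "\<exists>D. Vector_Spaces.linear (*s) (*s) D \<and> ((\<lambda>x. F (G x)) has_derivative D) (at x)"
    by blast
qed

lemma entire_map_funpow:
  fixes g :: "complex^'n \<Rightarrow> complex^'n"
  assumes "entire_map g"
  shows "entire_map (g ^^ n)"
proof (induction n)
  case 0
  show ?case unfolding funpow.simps id_def by (rule entire_map_id)
next
  case (Suc n)
  then show ?case using entire_map_compose[OF assms Suc] by (simp add: o_def)
qed

lemma scaleR_eq_vector_scalar_mult:
  fixes x :: "complex^'n"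
  shows "c *\<^sub>R x = complex_of_real c *s x"
  by (simp add: vec_eq_iff) (simp add: scaleR_conv_of_real)

lemma entire_map_scaleR: "entire_map (\<lambda>x::complex^'n. c *\<^sub>R x)"
proof -
  have "Vector_Spaces.linear (*s) (*s) (\<lambda>x::complex^'n. c *\<^sub>R x)"
    unfolding scaleR_eq_vector_scalar_mult by (rule vec.linear_scale_self)
  then show ?thesis
    unfolding entire_map_def
    by (metis bounded_linear_scaleR_right bounded_linear_imp_has_derivative)
qed

section \<open>Iterates of a map that is doubling up to second order\<close>

definition doubles_to_second_order :: "real \<Rightarrow> ('a::real_normed_vector \<Rightarrow> 'a) \<Rightarrow> bool" where
  "doubles_to_second_order C g \<longleftrightarrow> C \<ge> 0 \<and> g 0 = 0 \<and>
     (\<forall>x y. norm x \<le> 1 \<longrightarrow> norm y \<le> 1 \<longrightarrow>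
        norm (g x - g y - 2 *\<^sub>R (x - y)) \<le> C * (norm x + norm y) * norm (x - y))"

text \<open>The relative error \<open>2 ^ k / 2 ^ n / 2\<close> doubles with every step and is still
  only 1/2 at \<open>k = n\<close>. The k-th iterates have norm at most
  \<open>2 * \<rho> * 2 ^ k / 2 ^ n\<close>, and at that size \<open>g\<close> minus doubling has a
  proportionally small Lipschitz constant. The condition \<open>8 * C * \<rho> \<le> 1\<close>
  bounds the new error by the doubled bound on the inherited one.\<close>

lemma doubling_iterate_estimate:
  assumes g: "doubles_to_second_order C g"
    and rho: "\<rho> > 0" "8 * C * \<rho> \<le> 1" "2 * \<rho> \<le> 1"
    and kn: "k \<le> n"
    and x: "norm x \<le> \<rho> / 2 ^ n" and y: "norm y \<le> \<rho> / 2 ^ n"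
  shows "norm ((g ^^ k) x - (g ^^ k) y - 2 ^ k *\<^sub>R (x - y)) \<le> 2 ^ k * (2 ^ k / 2 ^ n / 2) * norm (x - y)"
  using kn x y
proof (induction k arbitrary: x y)
  case 0
  then show ?case by simp
next
  case (Suc k)
  define t :: real where "t = 2 ^ k / 2 ^ n"
  have t: "0 < t" "t \<le> 1"
    using Suc.prems(1) power_increasing[of k n "2::real"] by (auto simp: t_def)
  have g0: "(g ^^ j) 0 = 0" for j
    using g by (induction j) (auto simp: doubles_to_second_order_def)
  have close: "norm ((g ^^ k) a - (g ^^ k) b - 2 ^ k *\<^sub>R (a - b)) \<le> 2 ^ k * (t / 2) * norm (a - b)"
    if "norm a \<le> \<rho> / 2 ^ n" "norm b \<le> \<rho> / 2 ^ n" for a b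
    using Suc.IH[of a b] Suc.prems(1) that by (simp add: t_def)
  have lip: "norm ((g ^^ k) a - (g ^^ k) b) \<le> 2 * 2 ^ k * norm (a - b)"
    if "norm a \<le> \<rho> / 2 ^ n" "norm b \<le> \<rho> / 2 ^ n" for a b
  proof -
    have "norm ((g ^^ k) a - (g ^^ k) b) \<le> 2 ^ k * (t / 2) * norm (a - b) + norm (2 ^ k *\<^sub>R (a - b))"
      using close[OF that] norm_triangle_sub[of "(g ^^ k) a - (g ^^ k) b" "2 ^ k *\<^sub>R (a - b)"]
      by linarith
    also have "\<dots> = 2 ^ k * norm (a - b) * (t / 2 + 1)"
      by (simp add: algebra_simps del: scaleR_right_diff_distrib)
    also have "\<dots> \<le> 2 ^ k * norm (a - b) * 2"
      using t by (intro mult_left_mono) auto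
    finally show ?thesis by simp
  qed
  have size: "norm ((g ^^ k) a) \<le> 2 * \<rho> * t" if "norm a \<le> \<rho> / 2 ^ n" for a
  proof -
    have "norm ((g ^^ k) a) \<le> 2 * 2 ^ k * norm a"
      using lip[of a 0] that g0 rho by simp
    also have "\<dots> \<le> 2 * 2 ^ k * (\<rho> / 2 ^ n)"
      using that by (intro mult_left_mono) auto
    finally show ?thesis by (simp add: t_def mult_ac)
  qed
  define X Y where "X = (g ^^ k) x" and "Y = (g ^^ k) y"
  have XY: "norm X \<le> 2 * \<rho> * t" "norm Y \<le> 2 * \<rho> * t"
    using size Suc.prems by (auto simp: X_def Y_def)
  have "2 * \<rho> * t \<le> 1"
    using t rho mult_mono[of "2 * \<rho>" 1 t 1] by simp
  then have le1: "norm X \<le> 1" "norm Y \<le> 1"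
    using XY by linarith+
  have C0: "C \<ge> 0"
    using g by (simp add: doubles_to_second_order_def)
  have "norm (g X - g Y - 2 *\<^sub>R (X - Y)) \<le> C * (norm X + norm Y) * norm (X - Y)"
    using g le1 by (simp add: doubles_to_second_order_def)
  also have "\<dots> \<le> C * (4 * \<rho> * t) * (2 * 2 ^ k * norm (x - y))"
    using XY C0 t rho lip[of x y] Suc.prems
    by (intro mult_mono mult_left_mono) (auto simp: X_def Y_def)
  also have "\<dots> = (8 * C * \<rho>) * (t * 2 ^ k * norm (x - y))"
    by simp
  also have "\<dots> \<le> 1 * (t * 2 ^ k * norm (x - y))"
    using rho t by (intro mult_right_mono) auto
  finally have 1: "norm (g X - g Y - 2 *\<^sub>R (X - Y)) \<le> t * 2 ^ k * norm (x - y)"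
    by simp
  have 2: "norm (X - Y - 2 ^ k *\<^sub>R (x - y)) \<le> 2 ^ k * (t / 2) * norm (x - y)"
    using close Suc.prems by (simp add: X_def Y_def)
  have eq: "g X - g Y - 2 ^ Suc k *\<^sub>R (x - y)
      = (g X - g Y - 2 *\<^sub>R (X - Y)) + 2 *\<^sub>R (X - Y - 2 ^ k *\<^sub>R (x - y))"
    by (simp add: algebra_simps)
  have "norm (g X - g Y - 2 ^ Suc k *\<^sub>R (x - y))
      \<le> t * 2 ^ k * norm (x - y) + 2 * (2 ^ k * (t / 2) * norm (x - y))"
    unfolding eq
    by (rule norm_triangle_mono[OF 1]) (use 2 in simp)
  also have "\<dots> = 2 ^ Suc k * (2 ^ Suc k / 2 ^ n / 2) * norm (x - y)"
    by (simp add: t_def)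
  finally show ?case
    by (simp add: X_def Y_def)
qed

text \<open>These are the Koenigs iterates for the multiplier 2; their limit F inherits F(2x) =
  g(F(x)) from a shift of n by one. The type is a general real vector space because the same
  iterates are also taken of the tangent map, on a product.\<close>

definition renormalized :: "('a::real_vector \<Rightarrow> 'a) \<Rightarrow> nat \<Rightarrow> 'a \<Rightarrow> 'a" where
  "renormalized g n x = (g ^^ n) ((1 / 2 ^ n) *\<^sub>R x)"

text \<open>The iterates are the partial sums of a telescoping series dominated by a geometric one.
  The last conclusion says that the limit minus the identity is a contraction by 1/2, which later
  yields injectivity near 0.\<close>

lemma renormalized_uniform_limit:
  fixes g :: "'a::banach \<Rightarrow> 'a"
  assumes g: "doubles_to_second_order C g"
  obtains \<rho> F where "\<rho> > 0"
    and "uniform_limit (cball 0 \<rho>) (renormalized g) F sequentially"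
    and "\<And>x y. x \<in> cball 0 \<rho> \<Longrightarrow> y \<in> cball 0 \<rho> \<Longrightarrow> norm (F x - F y - (x - y)) \<le> norm (x - y) / 2"
proof -
  have C0: "C \<ge> 0"
    using g by (simp add: doubles_to_second_order_def)
  \<comment> \<open>One value meets both smallness conditions of
    \<open>doubling_iterate_estimate\<close>, also when \<open>C = 0\<close>.\<close>
  define R where "R = 1 / (8 * C + 8)"
  have R: "R > 0" "8 * C * R \<le> 1" "2 * R \<le> 1"
    using C0 by (auto simp: R_def field_simps)
  note est = doubling_iterate_estimate[OF g R]
  have close: "norm (renormalized g n x - renormalized g n y - (x - y)) \<le> norm (x - y) / 2"
    if "x \<in> cball 0 R" "y \<in> cball 0 R" for n x y
    using est[of n n "(1 / 2 ^ n) *\<^sub>R x" "(1 / 2 ^ n) *\<^sub>R y"] that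
    by (simp add: renormalized_def divide_right_mono flip: scaleR_diff_right)
  \<comment> \<open>With a = x / 2^(n+1) the two iterates are \<open>(g ^^ n) (g a)\<close> and
    \<open>(g ^^ n) (2 *\<^sub>R a)\<close>. The ball is halved because \<open>g a\<close> may have
    norm \<open>4 * norm a\<close>, which must not exceed \<open>R / 2 ^ n\<close>.\<close>
  have step: "norm (renormalized g (Suc n) x - renormalized g n x) \<le> C * (1 / 2) ^ n"
    if x: "x \<in> cball 0 (R / 2)" for n x
  proof -
    define a where "a = (1 / 2 ^ Suc n) *\<^sub>R x"
    have na: "norm a = norm x / 2 ^ Suc n"
      by (simp add: a_def)
    have nx: "norm x \<le> R / 2" "norm x \<le> 1"
      using x R by auto
    have na1: "norm a \<le> 1"
      unfolding na using nx(2) order_trans[OF nx(2) one_le_power[of "2::real" "Suc n"]] by (simp add: divide_le_eq del: power_Suc)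
    have "norm (g a - 2 *\<^sub>R a) \<le> C * norm a * norm a"
      using g na1 unfolding doubles_to_second_order_def
      by (elim conjE allE[of _ a] allE[of _ 0]) (auto dest!: spec[of _ 0])
    also have "\<dots> \<le> C * (1 / 2 ^ Suc n) * (1 / 2 ^ Suc n)"
      unfolding na using C0 nx(2) by (intro mult_mono) (auto simp: divide_right_mono)
    finally have ga: "norm (g a - 2 *\<^sub>R a) \<le> C * (1 / 2 ^ Suc n) * (1 / 2 ^ Suc n)" .
    have "norm (g a) \<le> 4 * norm a"
    proof -
      have "norm ((g ^^ 1) a - (g ^^ 1) 0 - 2 ^ 1 *\<^sub>R (a - 0)) \<le> 2 ^ 1 * (2 ^ 1 / 2 ^ Suc n / 2) * norm (a - 0)"
        using R nx by (intro est) (auto simp: na divide_right_mono)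
      moreover have "g 0 = 0"
        using g by (simp add: doubles_to_second_order_def)
      ultimately have "norm (g a - 2 *\<^sub>R a) \<le> 2 * (1 / 2 ^ Suc n) * norm a"
        by simp
      also have "\<dots> \<le> 2 * 1 * norm a"
        by (intro mult_right_mono mult_left_mono) (auto simp: divide_le_eq_1 one_le_power simp del: power_Suc)
      finally show ?thesis by norm
    qed
    then have b: "norm (g a) \<le> R / 2 ^ n" "norm (2 *\<^sub>R a) \<le> R / 2 ^ n"
      using nx R by (auto simp: na divide_simps)
    have "norm ((g ^^ n) (g a) - (g ^^ n) (2 *\<^sub>R a) - 2 ^ n *\<^sub>R (g a - 2 *\<^sub>R a))
        \<le> 2 ^ n * (2 ^ n / 2 ^ n / 2) * norm (g a - 2 *\<^sub>R a)"
      using b by (intro est) auto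
    then have "norm ((g ^^ n) (g a) - (g ^^ n) (2 *\<^sub>R a))
        \<le> 2 ^ n / 2 * norm (g a - 2 *\<^sub>R a) + norm (2 ^ n *\<^sub>R (g a - 2 *\<^sub>R a))"
      using norm_triangle_sub[of "(g ^^ n) (g a) - (g ^^ n) (2 *\<^sub>R a)" "2 ^ n *\<^sub>R (g a - 2 *\<^sub>R a)"]
      by simp
    also have "\<dots> = (3 / 2) * 2 ^ n * norm (g a - 2 *\<^sub>R a)"
      by simp
    also have "\<dots> \<le> (3 / 2) * 2 ^ n * (C * (1 / 2 ^ Suc n) * (1 / 2 ^ Suc n))"
      using ga by (intro mult_left_mono) auto
    also have "\<dots> \<le> C * (1 / 2) ^ n"
      using C0 by (simp add: field_simps power_one_over)
    finally show ?thesis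
      by (simp add: renormalized_def a_def funpow_swap1)
  qed
  define F where "F x = (\<Sum>i. renormalized g (Suc i) x - renormalized g i x) + x" for x
  have "uniform_limit (cball 0 (R / 2))
      (\<lambda>n x. \<Sum>i<n. renormalized g (Suc i) x - renormalized g i x)
      (\<lambda>x. \<Sum>i. renormalized g (Suc i) x - renormalized g i x) sequentially"
    by (rule Weierstrass_m_test[where M = "\<lambda>n. C * (1 / 2) ^ n"])
      (use step in \<open>auto intro!: summable_mult summable_geometric\<close>)
  then have "uniform_limit (cball 0 (R / 2))
      (\<lambda>n x. (\<Sum>i<n. renormalized g (Suc i) x - renormalized g i x) + x) F sequentially"
    unfolding F_def by (intro uniform_limit_intros)
  moreover have "(\<lambda>n x. (\<Sum>i<n. renormalized g (Suc i) x - renormalized g i x) + x) = renormalized g"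
    by (intro ext, subst sum_lessThan_telescope) (simp add: renormalized_def)
  ultimately have lim: "uniform_limit (cball 0 (R / 2)) (renormalized g) F sequentially"
    by simp
  show thesis
  proof (rule that[of "R / 2" F])
    show "R / 2 > 0" using R by simp
    show "norm (F x - F y - (x - y)) \<le> norm (x - y) / 2"
      if "x \<in> cball 0 (R / 2)" "y \<in> cball 0 (R / 2)" for x y
    proof (rule tendsto_upperbound)
      show "(\<lambda>n. norm (renormalized g n x - renormalized g n y - (x - y))) \<longlonglongrightarrow> norm (F x - F y - (x - y))"
        using tendsto_uniform_limitI[OF lim] that by (intro tendsto_intros) auto
      show "\<forall>\<^sub>F n in sequentially. norm (renormalized g n x - renormalized g n y - (x - y)) \<le> norm (x - y) / 2"
        using that R by (intro always_eventually allI close) auto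
    qed simp
  qed (rule lim)
qed

lemma renormalized_0: "renormalized g n 0 = (g ^^ n) 0"
  by (simp add: renormalized_def)

lemma renormalized_Suc_double: "renormalized g (Suc n) (2 *\<^sub>R x) = g (renormalized g n x)"
  by (simp add: renormalized_def)

lemma renormalized_add:
  "renormalized g (N + n) x = (g ^^ N) (renormalized g n ((1 / 2 ^ N) *\<^sub>R x))"
  by (simp add: renormalized_def funpow_add power_add mult.commute)

section \<open>Tangent maps: iterating a map together with its derivative\<close>

definition tangent_map :: "('a \<Rightarrow> 'a) \<Rightarrow> ('a \<Rightarrow> 'a \<Rightarrow> 'a) \<Rightarrow> 'a \<times> 'a \<Rightarrow> 'a \<times> 'a" where
  "tangent_map g dg p = (g (fst p), dg (fst p) (snd p))"

lemma fst_tangent_map [simp]: "fst (tangent_map g dg p) = g (fst p)"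
  and snd_tangent_map [simp]: "snd (tangent_map g dg p) = dg (fst p) (snd p)"
  by (simp_all only: tangent_map_def fst_conv snd_conv)

lemma fst_tangent_map_funpow: "fst ((tangent_map g dg ^^ n) (x, v)) = (g ^^ n) x"
  by (induction n) auto

lemma fst_renormalized_tangent_map:
  "fst (renormalized (tangent_map g dg) n (x, v)) = renormalized g n x"
  by (simp add: renormalized_def fst_tangent_map_funpow)

lemma tangent_map_funpow_has_derivative:
  assumes "\<And>x. (g has_derivative dg x) (at x)"
  shows "((g ^^ n) has_derivative (\<lambda>v. snd ((tangent_map g dg ^^ n) (x, v)))) (at x)"
proof (induction n)
  case 0
  then show ?case by (simp add: id_def)
next
  case (Suc n)
  show ?case
    using has_derivative_compose[OF Suc assms[of "(g ^^ n) x"]]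
    by (simp add: fst_tangent_map_funpow o_def)
qed

lemma tangent_map_funpow_linear:
  fixes g :: "complex^'n \<Rightarrow> complex^'n"
  assumes "\<And>x. Vector_Spaces.linear (*s) (*s) (dg x)"
  shows "Vector_Spaces.linear (*s) (*s) (\<lambda>v. snd ((tangent_map g dg ^^ n) (x, v)))"
proof (induction n)
  case 0
  then show ?case by (simp add: linear_vec_iff)
next
  case (Suc n)
  then show ?case
    using assms by (simp add: linear_vec_iff fst_tangent_map_funpow)
qed

lemma renormalized_has_derivative:
  assumes "\<And>x. (g has_derivative dg x) (at x)"
  shows "(renormalized g n has_derivative (\<lambda>v. snd (renormalized (tangent_map g dg) n (x, v)))) (at x)"
proof -
  have "((\<lambda>x. (g ^^ n) ((1 / 2 ^ n) *\<^sub>R x)) has_derivative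
      (\<lambda>v. snd ((tangent_map g dg ^^ n) ((1 / 2 ^ n) *\<^sub>R x, (1 / 2 ^ n) *\<^sub>R v)))) (at x)"
    by (rule has_derivative_compose[OF _ tangent_map_funpow_has_derivative[OF assms]])
      (auto intro!: derivative_eq_intros)
  then show ?thesis
    by (simp add: renormalized_def[abs_def])
qed

lemma renormalized_tangent_linear:
  fixes g :: "complex^'n \<Rightarrow> complex^'n"
  assumes "\<And>x. Vector_Spaces.linear (*s) (*s) (dg x)"
  shows "Vector_Spaces.linear (*s) (*s) (\<lambda>v. snd (renormalized (tangent_map g dg) n (x, v)))"
  using tangent_map_funpow_linear[where g=g and n=n and x="(1 / 2 ^ n) *\<^sub>R x" and dg=dg, OF assms]
  unfolding renormalized_def
  by (simp add: linear_vec_iff scaleR_add_right scaleR_eq_vector_scalar_mult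
      vec.scale_left_commute[of _ "complex_of_real _"] del: of_real_divide)

text \<open>The renormalised iterates of the tangent map are those of \<^term>\<open>g\<close> together with their
  derivatives, so that one convergence lemma yields a differentiable limit.\<close>

lemma poincare_local:
  fixes g :: "complex^'n \<Rightarrow> complex^'n"
  assumes deriv: "\<And>x. (g has_derivative dg x) (at x)"
    and lin: "\<And>x. Vector_Spaces.linear (*s) (*s) (dg x)"
    and G: "doubles_to_second_order C (tangent_map g dg)"
  obtains \<rho> F where "\<rho> > 0"
    and "\<And>x. x \<in> cball 0 \<rho> \<Longrightarrow> (\<lambda>n. renormalized g n x) \<longlonglongrightarrow> F x"
    and "\<And>x y. x \<in> cball 0 \<rho> \<Longrightarrow> y \<in> cball 0 \<rho> \<Longrightarrow> norm (F x - F y - (x - y)) \<le> norm (x - y) / 2"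
    and "\<And>x. x \<in> ball 0 \<rho> \<Longrightarrow> \<exists>D. Vector_Spaces.linear (*s) (*s) D \<and> (F has_derivative D) (at x)"
proof -
  let ?G = "tangent_map g dg"
  obtain R \<Phi> where R: "R > 0"
    and lim: "uniform_limit (cball 0 R) (renormalized ?G) \<Phi> sequentially"
    and near: "\<And>p q. p \<in> cball 0 R \<Longrightarrow> q \<in> cball 0 R \<Longrightarrow> norm (\<Phi> p - \<Phi> q - (p - q)) \<le> norm (p - q) / 2"
    using renormalized_uniform_limit[OF G] by blast
  \<comment> \<open>The norm of a pair is at most the sum of the norms, so half the radius is left
    to the point and half to the tangent vector.\<close>
  define \<rho> where "\<rho> = R / 2"
  have rho: "\<rho> > 0" using R by (simp add: \<rho>_def)
  have in_ball: "(x, v) \<in> cball 0 R" if "norm x \<le> \<rho>" "norm v \<le> \<rho>" for x v :: "complex^'n"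
    using norm_Pair_le[of x v] that by (simp add: \<rho>_def)
  define F where "F x = fst (\<Phi> (x, 0))" for x
  have limF: "(\<lambda>n. renormalized g n x) \<longlonglongrightarrow> F x" if "norm x \<le> \<rho>" for x
    using tendsto_fst[OF tendsto_uniform_limitI[OF lim in_ball[OF that, of 0]]] rho
    by (simp add: fst_renormalized_tangent_map F_def)
  define DF where "DF n x v = snd (renormalized ?G n (x, v))" for n x v
  have DF_scale: "DF n x (c *\<^sub>R v) = c *\<^sub>R DF n x v" for n x c v
    using renormalized_tangent_linear[where g=g and n=n and x=x and dg=dg, OF lin]
    by (simp add: DF_def linear_vec_iff scaleR_eq_vector_scalar_mult)
  \<comment> \<open>\<open>\<Phi>\<close> is under control on a ball only, so the limit derivative
    is read off at tangent vectors of norm \<open>\<rho>\<close> and extended by homogeneity. For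
    \<open>v = 0\<close> the prefactor vanishes, which gives the right value 0.\<close>
  define dF where "dF x v = (norm v / \<rho>) *\<^sub>R snd (\<Phi> (x, (\<rho> / norm v) *\<^sub>R v))" for x v
  \<comment> \<open>This is convergence in operator norm, uniformly in \<open>x\<close>, as termwise
    differentiation requires; a tolerance of \<open>e * \<rho>\<close> on vectors of norm
    \<open>\<rho>\<close> becomes \<open>e\<close> after rescaling.\<close>
  have DF_conv: "\<forall>\<^sub>F n in sequentially. \<forall>x\<in>ball 0 \<rho>. \<forall>h. norm (DF n x h - dF x h) \<le> e * norm h"
    if "e > 0" for e
  proof -
    have "\<forall>\<^sub>F n in sequentially. \<forall>p\<in>cball 0 R. dist (renormalized ?G n p) (\<Phi> p) < e * \<rho>"
      using uniform_limitD[OF lim] that rho by simp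
    then show ?thesis
    proof (eventually_elim, intro ballI allI)
      fix n and x h :: "complex^'n"
      assume n: "\<forall>p\<in>cball 0 R. dist (renormalized ?G n p) (\<Phi> p) < e * \<rho>" and x: "x \<in> ball 0 \<rho>"
      show "norm (DF n x h - dF x h) \<le> e * norm h"
      proof (cases "h = 0")
        case True
        then show ?thesis using DF_scale[of n x 0 0] by (simp add: dF_def)
      next
        case False
        define u where "u = (\<rho> / norm h) *\<^sub>R h"
        have u: "norm u \<le> \<rho>" and h: "h = (norm h / \<rho>) *\<^sub>R u"
          using False rho by (auto simp: u_def)
        have "DF n x h - dF x h = (norm h / \<rho>) *\<^sub>R (DF n x u - snd (\<Phi> (x, u)))"
          using DF_scale[of n x "norm h / \<rho>" u] h by (simp add: dF_def u_def algebra_simps)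
        also have "norm \<dots> \<le> (norm h / \<rho>) * (e * \<rho>)"
        proof -
          have "norm (DF n x u - snd (\<Phi> (x, u))) \<le> dist (renormalized ?G n (x, u)) (\<Phi> (x, u))"
            unfolding DF_def by (metis dist_norm dist_snd_le)
          also have "\<dots> \<le> e * \<rho>"
            using n in_ball[of x u] u x by (simp add: less_imp_le)
          finally have "norm (DF n x u - snd (\<Phi> (x, u))) \<le> e * \<rho>" .
          from mult_left_mono[OF this, of "norm h / \<rho>"] show ?thesis
            using rho by simp
        qed
        finally show ?thesis using rho by (simp add: mult.commute)
      qed
    qed
  qed
  have "\<exists>F'. \<forall>x\<in>ball 0 \<rho>. (\<lambda>n. renormalized g n x) \<longlonglongrightarrow> F' x \<and> (F' has_derivative dF x) (at x within ball 0 \<rho>)"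
  proof (rule has_derivative_sequence)
    show "(renormalized g n has_derivative DF n x) (at x within ball 0 \<rho>)" for n x
      unfolding DF_def using renormalized_has_derivative[OF deriv] by (rule has_derivative_at_withinI)
    show "(\<lambda>n. renormalized g n 0) \<longlonglongrightarrow> F 0"
      using limF rho by simp
  qed (use DF_conv rho in auto)
  then obtain F' where F': "\<And>x. x \<in> ball 0 \<rho> \<Longrightarrow> (\<lambda>n. renormalized g n x) \<longlonglongrightarrow> F' x"
      "\<And>x. x \<in> ball 0 \<rho> \<Longrightarrow> (F' has_derivative dF x) (at x within ball 0 \<rho>)"
    by blast
  have F'_eq: "F' x = F x" if "x \<in> ball 0 \<rho>" for x
    using LIMSEQ_unique[OF F'(1)[OF that] limF] that by simp
  show thesis
  proof (rule that[of \<rho> F])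
    show "norm (F x - F y - (x - y)) \<le> norm (x - y) / 2" if "x \<in> cball 0 \<rho>" "y \<in> cball 0 \<rho>" for x y
    proof -
      have "F x - F y - (x - y) = fst (\<Phi> (x, 0) - \<Phi> (y, 0) - ((x, 0) - (y, 0)))"
        by (simp add: F_def)
      also have "norm \<dots> \<le> norm (\<Phi> (x, 0) - \<Phi> (y, 0) - ((x, 0) - (y, 0)))"
        by (metis norm_fst_le prod.collapse)
      also have "\<dots> \<le> norm ((x, 0::complex^'n) - (y, 0)) / 2"
        using that rho by (intro near in_ball) auto
      finally show ?thesis by simp
    qed
    show "\<exists>D. Vector_Spaces.linear (*s) (*s) D \<and> (F has_derivative D) (at x)" if x: "x \<in> ball 0 \<rho>" for x
    proof (intro exI conjI)
      \<comment> \<open>Complex linearity passes to the limit for each fixed \<open>v\<close>, so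
        pointwise convergence is extracted here.\<close>
      have DF_lim: "(\<lambda>n. DF n x v) \<longlonglongrightarrow> dF x v" for v
      proof (rule tendstoI)
        fix e :: real
        assume e: "e > 0"
        have "e / (norm v + 1) > 0" using e by (simp add: add_nonneg_pos)
        from DF_conv[OF this] show "\<forall>\<^sub>F n in sequentially. dist (DF n x v) (dF x v) < e"
        proof eventually_elim
          case (elim n)
          then have "norm (DF n x v - dF x v) \<le> e / (norm v + 1) * norm v"
            using x by blast
          also have "\<dots> < e"
            using e by (simp add: divide_simps add_nonneg_pos)
          finally show ?case by (simp add: dist_norm)
        qed
      qed
      have add: "DF n x (u + v) = DF n x u + DF n x v" and scale: "DF n x (c *s v) = c *s DF n x v" for n u v c
        using renormalized_tangent_linear[where g=g and n=n and x=x and dg=dg, OF lin] by (auto simp: DF_def linear_vec_iff)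
      have cont: "(\<lambda>n. c *s DF n x v) \<longlonglongrightarrow> c *s dF x v" for c v
        by (rule vec_tendstoI) (auto intro!: tendsto_intros tendsto_vec_nth DF_lim)
      have "dF x (u + v) = dF x u + dF x v" for u v
        using LIMSEQ_unique[OF DF_lim[of "u + v"]] tendsto_add[OF DF_lim DF_lim] by (simp add: add)
      moreover have "dF x (c *s v) = c *s dF x v" for c v
        using LIMSEQ_unique[OF DF_lim[of "c *s v"]] cont by (simp add: scale)
      ultimately show "Vector_Spaces.linear (*s) (*s) (dF x)"
        by (simp add: linear_vec_iff)
      have "(F' has_derivative dF x) (at x)"
        using F'(2)[OF x] at_within_open[OF x open_ball] by simp
      then show "(F has_derivative dF x) (at x)"
        by (rule has_derivative_transform_within_open[OF _ open_ball x F'_eq])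
    qed
  qed (use limF rho in auto)
qed

text \<open>The functional equation spreads the local limit over the whole space: x / 2^N lies in
  the small ball for large N, and there F(x) = g^N(F0(x / 2^N)). Differentiability and injectivity
  of F are then inherited from the local map, the iterates of \<open>g\<close> and the
  scaling.\<close>

lemma poincare_map_exists:
  fixes g :: "complex^'n \<Rightarrow> complex^'n"
  assumes deriv: "\<And>x. (g has_derivative dg x) (at x)"
    and lin: "\<And>x. Vector_Spaces.linear (*s) (*s) (dg x)"
    and G: "doubles_to_second_order C (tangent_map g dg)"
    and "inj g"
  obtains F :: "complex^'n \<Rightarrow> complex^'n"
  where "entire_map F" "inj F" "F 0 = 0" "\<And>x. F (2 *\<^sub>R x) = g (F x)"
proof -
  obtain \<rho> F0 where rho: "\<rho> > 0"
    and lim0: "\<And>x. x \<in> cball 0 \<rho> \<Longrightarrow> (\<lambda>n. renormalized g n x) \<longlonglongrightarrow> F0 x"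
    and near: "\<And>x y. x \<in> cball 0 \<rho> \<Longrightarrow> y \<in> cball 0 \<rho> \<Longrightarrow> norm (F0 x - F0 y - (x - y)) \<le> norm (x - y) / 2"
    and diff: "\<And>x. x \<in> ball 0 \<rho> \<Longrightarrow> \<exists>D. Vector_Spaces.linear (*s) (*s) D \<and> (F0 has_derivative D) (at x)"
    using poincare_local[OF deriv lin G] by blast
  have g_entire: "entire_map g"
    using deriv lin unfolding entire_map_def by blast
  have cont: "isCont (g ^^ N) x" for N x
    using entire_map_funpow[OF g_entire, of N] has_derivative_continuous
    unfolding entire_map_def by blast
  define F where "F x = lim (\<lambda>n. renormalized g n x)" for x
  have small: "\<exists>N. \<forall>n\<ge>N. (1 / 2 ^ n) *\<^sub>R x \<in> ball 0 \<rho>" for x :: "complex^'n"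
  proof -
    have "(\<lambda>n. (1 / 2) ^ n *\<^sub>R x) \<longlonglongrightarrow> 0 *\<^sub>R x"
      by (intro tendsto_scaleR LIMSEQ_power_zero tendsto_const) auto
    then have "\<forall>\<^sub>F n in sequentially. dist ((1 / 2) ^ n *\<^sub>R x) 0 < \<rho>"
      using rho by (intro tendstoD) auto
    then show ?thesis
      by (simp add: eventually_sequentially power_one_over)
  qed
  have lim_scaled: "(\<lambda>n. renormalized g n x) \<longlonglongrightarrow> (g ^^ N) (F0 ((1 / 2 ^ N) *\<^sub>R x))"
    if "(1 / 2 ^ N) *\<^sub>R x \<in> ball 0 \<rho>" for N x
  proof -
    have "(\<lambda>n. renormalized g n ((1 / 2 ^ N) *\<^sub>R x)) \<longlonglongrightarrow> F0 ((1 / 2 ^ N) *\<^sub>R x)"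
      by (rule lim0) (use that in auto)
    then have "(\<lambda>n. renormalized g (N + n) x) \<longlonglongrightarrow> (g ^^ N) (F0 ((1 / 2 ^ N) *\<^sub>R x))"
      unfolding renormalized_add by (rule isCont_tendsto_compose[OF cont])
    then show ?thesis
      by (simp add: add.commute LIMSEQ_offset[of _ N])
  qed
  have F_eq: "F x = (g ^^ N) (F0 ((1 / 2 ^ N) *\<^sub>R x))" if "(1 / 2 ^ N) *\<^sub>R x \<in> ball 0 \<rho>" for N x
    unfolding F_def by (rule limI[OF lim_scaled[OF that]])
  have limF: "(\<lambda>n. renormalized g n x) \<longlonglongrightarrow> F x" for x
    using small[of x] lim_scaled F_eq by (metis order_refl)
  show thesis
  proof (rule that)
    have "g 0 = 0"
      using G by (simp add: doubles_to_second_order_def tangent_map_def zero_prod_def)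
    then have "(g ^^ n) 0 = 0" for n
      by (induction n) auto
    then show "F 0 = 0"
      using limF[of 0] by (simp add: renormalized_0 LIMSEQ_const_iff)
    show "F (2 *\<^sub>R x) = g (F x)" for x
    proof (rule LIMSEQ_unique)
      show "(\<lambda>n. renormalized g (Suc n) (2 *\<^sub>R x)) \<longlonglongrightarrow> F (2 *\<^sub>R x)"
        using limF by (rule LIMSEQ_Suc)
      show "(\<lambda>n. renormalized g (Suc n) (2 *\<^sub>R x)) \<longlonglongrightarrow> g (F x)"
        unfolding renormalized_Suc_double
        using isCont_tendsto_compose[OF cont[where N=1] limF] by simp
    qed
    show "inj F"
    proof (rule injI)
      fix x y
      assume eq: "F x = F y"
      obtain N where N: "(1 / 2 ^ N) *\<^sub>R x \<in> ball 0 \<rho>" "(1 / 2 ^ N) *\<^sub>R y \<in> ball 0 \<rho>"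
        using small[of x] small[of y] by (meson max.cobounded1 max.cobounded2)
      have "inj (g ^^ N)"
        using \<open>inj g\<close> by (rule inj_fn)
      then have "F0 ((1 / 2 ^ N) *\<^sub>R x) = F0 ((1 / 2 ^ N) *\<^sub>R y)"
        using eq F_eq[OF N(1)] F_eq[OF N(2)] by (simp add: inj_eq)
      \<comment> \<open>With equal values of \<open>F0\<close>, the estimate \<open>near\<close>
        bounds the norm of the difference of the arguments by half of itself.\<close>
      then have "norm ((1 / 2 ^ N) *\<^sub>R x - (1 / 2 ^ N) *\<^sub>R y) \<le> norm ((1 / 2 ^ N) *\<^sub>R x - (1 / 2 ^ N) *\<^sub>R y) / 2"
        using near[of "(1 / 2 ^ N) *\<^sub>R x" "(1 / 2 ^ N) *\<^sub>R y"] N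
        by (simp add: less_imp_le norm_minus_commute)
      then have "norm ((1 / 2 ^ N) *\<^sub>R x - (1 / 2 ^ N) *\<^sub>R y) = 0"
        using norm_ge_zero by (smt (verit) field_sum_of_halves)
      then show "x = y"
        by simp
    qed
    show "entire_map F"
      unfolding entire_map_def
    proof
      fix x :: "complex^'n"
      obtain N where N: "(1 / 2 ^ N) *\<^sub>R x \<in> ball 0 \<rho>"
        using small[of x] by blast
      \<comment> \<open>The exponent \<open>N\<close> depends on the point, but one \<open>N\<close>
        serves a whole neighbourhood, which is enough for the derivative.\<close>
      define U where "U = (\<lambda>y::complex^'n. (1 / 2 ^ N) *\<^sub>R y) -` ball 0 \<rho>"
      have U: "open U" "x \<in> U"
        using N by (auto simp: U_def intro!: open_vimage continuous_intros)
      obtain A where A: "Vector_Spaces.linear (*s) (*s) A" "((\<lambda>y::complex^'n. (1 / 2 ^ N) *\<^sub>R y) has_derivative A) (at x)"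
        using entire_map_scaleR unfolding entire_map_def by blast
      obtain B where B: "Vector_Spaces.linear (*s) (*s) B" "(F0 has_derivative B) (at ((1 / 2 ^ N) *\<^sub>R x))"
        using diff[OF N] by blast
      obtain D where D: "Vector_Spaces.linear (*s) (*s) D" "((g ^^ N) has_derivative D) (at (F0 ((1 / 2 ^ N) *\<^sub>R x)))"
        using entire_map_funpow[OF g_entire] unfolding entire_map_def by blast
      have "((\<lambda>y. (g ^^ N) (F0 ((1 / 2 ^ N) *\<^sub>R y))) has_derivative (\<lambda>v. D (B (A v)))) (at x)"
        by (rule has_derivative_compose[OF has_derivative_compose[OF A(2) B(2)] D(2)])
      then have "(F has_derivative (\<lambda>v. D (B (A v)))) (at x)"
        by (rule has_derivative_transform_within_open[OF _ U]) (simp add: U_def F_eq)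
      moreover have "Vector_Spaces.linear (*s) (*s) (\<lambda>v. D (B (A v)))"
        using A(1) B(1) D(1) by (simp add: linear_vec_iff)
      ultimately show "\<exists>D. Vector_Spaces.linear (*s) (*s) D \<and> (F has_derivative D) (at x)"
        by blast
    qed
  qed
qed

subsection \<open>A Fatou-Bieberbach domain missing a cone\<close>

definition lipschitz_vanishing :: "('a::real_normed_vector \<Rightarrow> 'b::real_normed_vector) \<Rightarrow> bool" where
  "lipschitz_vanishing \<phi> \<longleftrightarrow> \<phi> 0 = 0 \<and>
     (\<exists>L\<ge>0. \<forall>x y. norm x \<le> 1 \<longrightarrow> norm y \<le> 1 \<longrightarrow> norm (\<phi> x - \<phi> y) \<le> L * norm (x - y))"

text \<open>This is the estimate of \<open>doubles_to_second_order\<close>, imposed on a remainder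
  such as \<open>g x - 2 *\<^sub>R x\<close>. With the constant quantified away, it can be checked
  by closure rules along the build-up of a polynomial map.\<close>

definition second_order :: "('a::real_normed_vector \<Rightarrow> 'b::real_normed_vector) \<Rightarrow> bool" where
  "second_order \<phi> \<longleftrightarrow>
     (\<exists>C\<ge>0. \<forall>x y. norm x \<le> 1 \<longrightarrow> norm y \<le> 1 \<longrightarrow>
        norm (\<phi> x - \<phi> y) \<le> C * (norm x + norm y) * norm (x - y))"

lemma lipschitz_vanishing_bounded_linear:
  assumes "bounded_linear \<phi>"
  shows "lipschitz_vanishing \<phi>"
proof -
  interpret bounded_linear \<phi> by fact
  obtain K where "0 \<le> K" "\<And>x. norm (\<phi> x) \<le> norm x * K"
    using nonneg_bounded by blast
  then show ?thesis
    unfolding lipschitz_vanishing_def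
    by (auto simp: zero mult.commute simp flip: diff intro!: exI[of _ K])
qed

lemma lipschitz_vanishing_diff:
  assumes "lipschitz_vanishing \<phi>" "lipschitz_vanishing \<psi>"
  shows "lipschitz_vanishing (\<lambda>x. \<phi> x - \<psi> x)"
proof -
  obtain K L where K: "K \<ge> 0" "\<And>x y. norm x \<le> 1 \<Longrightarrow> norm y \<le> 1 \<Longrightarrow> norm (\<phi> x - \<phi> y) \<le> K * norm (x - y)"
    and L: "L \<ge> 0" "\<And>x y. norm x \<le> 1 \<Longrightarrow> norm y \<le> 1 \<Longrightarrow> norm (\<psi> x - \<psi> y) \<le> L * norm (x - y)"
    using assms unfolding lipschitz_vanishing_def by blast
  have "norm (\<phi> x - \<psi> x - (\<phi> y - \<psi> y)) \<le> (K + L) * norm (x - y)" if "norm x \<le> 1" "norm y \<le> 1" for x y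
    using norm_triangle_ineq4[of "\<phi> x - \<phi> y" "\<psi> x - \<psi> y"] K(2)[OF that] L(2)[OF that]
    by (simp add: algebra_simps)
  then show ?thesis
    using assms K(1) L(1) unfolding lipschitz_vanishing_def by (auto intro!: exI[of _ "K + L"])
qed

lemma second_order_mult:
  fixes \<phi> \<psi> :: "'a::real_normed_vector \<Rightarrow> 'b::real_normed_algebra"
  assumes "lipschitz_vanishing \<phi>" "lipschitz_vanishing \<psi>"
  shows "second_order (\<lambda>x. \<phi> x * \<psi> x)"
proof -
  obtain K L where K: "K \<ge> 0" "\<And>x y. norm x \<le> 1 \<Longrightarrow> norm y \<le> 1 \<Longrightarrow> norm (\<phi> x - \<phi> y) \<le> K * norm (x - y)"
    and L: "L \<ge> 0" "\<And>x y. norm x \<le> 1 \<Longrightarrow> norm y \<le> 1 \<Longrightarrow> norm (\<psi> x - \<psi> y) \<le> L * norm (x - y)"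
    and 0: "\<phi> 0 = 0" "\<psi> 0 = 0"
    using assms unfolding lipschitz_vanishing_def by blast
  have "norm (\<phi> x * \<psi> x - \<phi> y * \<psi> y) \<le> (K * L) * (norm x + norm y) * norm (x - y)"
    if "norm x \<le> 1" "norm y \<le> 1" for x y
  proof -
    have "\<phi> x * \<psi> x - \<phi> y * \<psi> y = \<phi> x * (\<psi> x - \<psi> y) + (\<phi> x - \<phi> y) * \<psi> y"
      by (simp add: algebra_simps)
    also have "norm \<dots> \<le> norm (\<phi> x) * norm (\<psi> x - \<psi> y) + norm (\<phi> x - \<phi> y) * norm (\<psi> y)"
      by (intro norm_triangle_mono norm_mult_ineq)
    also have "\<dots> \<le> (K * norm x) * (L * norm (x - y)) + (K * norm (x - y)) * (L * norm y)"
      using K(2)[of x 0] L(2)[of y 0] K(2)[OF that] L(2)[OF that] K(1) L(1) that 0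
      by (intro add_mono mult_mono) auto
    finally show ?thesis by (simp add: algebra_simps)
  qed
  then show ?thesis
    using K(1) L(1) unfolding second_order_def by (auto intro!: exI[of _ "K * L"])
qed

text \<open>On the unit ball \<open>norm x + norm y\<close> is at most 2. This lets a quadratic
  expression become a factor of the next product, as the nested squares of \<open>henon_inv\<close>
  demand.\<close>

lemma lipschitz_vanishing_second_order:
  assumes "second_order \<phi>" "\<phi> 0 = 0"
  shows "lipschitz_vanishing \<phi>"
proof -
  obtain C where C: "C \<ge> 0"
    "\<And>x y. norm x \<le> 1 \<Longrightarrow> norm y \<le> 1 \<Longrightarrow> norm (\<phi> x - \<phi> y) \<le> C * (norm x + norm y) * norm (x - y)"
    using assms(1) unfolding second_order_def by blast
  have "norm (\<phi> x - \<phi> y) \<le> (C * 2) * norm (x - y)" if "norm x \<le> 1" "norm y \<le> 1" for x y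
    using C(1) that by (intro order_trans[OF C(2)[OF that]] mult_right_mono mult_left_mono) auto
  then show ?thesis
    using assms(2) C(1) unfolding lipschitz_vanishing_def by (auto intro!: exI[of _ "C * 2"])
qed

lemma second_order_bounded_linear_compose:
  assumes "bounded_linear A" "second_order \<phi>"
  shows "second_order (\<lambda>x. A (\<phi> x))"
proof -
  interpret bounded_linear A by fact
  obtain K where K: "0 \<le> K" "\<And>x. norm (A x) \<le> norm x * K"
    using nonneg_bounded by blast
  obtain C where C: "C \<ge> 0"
    "\<And>x y. norm x \<le> 1 \<Longrightarrow> norm y \<le> 1 \<Longrightarrow> norm (\<phi> x - \<phi> y) \<le> C * (norm x + norm y) * norm (x - y)"
    using assms(2) unfolding second_order_def by blast
  have "norm (A (\<phi> x) - A (\<phi> y)) \<le> (K * C) * (norm x + norm y) * norm (x - y)"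
    if "norm x \<le> 1" "norm y \<le> 1" for x y
    using order_trans[OF K(2)[of "\<phi> x - \<phi> y"] mult_right_mono[OF C(2)[OF that] K(1)]]
    by (simp add: diff mult_ac)
  then show ?thesis
    using K(1) C(1) unfolding second_order_def by (auto intro!: exI[of _ "K * C"])
qed

lemma second_order_add:
  assumes "second_order \<phi>" "second_order \<psi>"
  shows "second_order (\<lambda>x. \<phi> x + \<psi> x)"
proof -
  obtain K L where K: "K \<ge> 0" "\<And>x y. norm x \<le> 1 \<Longrightarrow> norm y \<le> 1 \<Longrightarrow>
      norm (\<phi> x - \<phi> y) \<le> K * (norm x + norm y) * norm (x - y)"
    and L: "L \<ge> 0" "\<And>x y. norm x \<le> 1 \<Longrightarrow> norm y \<le> 1 \<Longrightarrow>
      norm (\<psi> x - \<psi> y) \<le> L * (norm x + norm y) * norm (x - y)"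
    using assms unfolding second_order_def by meson
  have "norm (\<phi> x + \<psi> x - (\<phi> y + \<psi> y)) \<le> (K + L) * (norm x + norm y) * norm (x - y)"
    if "norm x \<le> 1" "norm y \<le> 1" for x y
    using norm_triangle_ineq[of "\<phi> x - \<phi> y" "\<psi> x - \<psi> y"] K(2)[OF that] L(2)[OF that]
    by (simp add: algebra_simps)
  then show ?thesis
    using K(1) L(1) unfolding second_order_def by (auto intro!: exI[of _ "K + L"])
qed

lemma vec2_eq_axis_add: "(x::'a::comm_monoid_add^2) = axis 1 (x $ 1) + axis 2 (x $ 2)"
  by (simp add: vec_eq_iff axis_def forall_2)

lemma bounded_linear_axis: "bounded_linear (axis i :: 'a::euclidean_space \<Rightarrow> 'a^'n)"
  unfolding linear_conv_bounded_linear[symmetric]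
  by (rule linearI) (auto simp: vec_eq_iff axis_def)

lemma second_order_vec2:
  fixes \<phi> :: "'a::real_normed_vector \<Rightarrow> complex^2"
  assumes "second_order (\<lambda>x. \<phi> x $ 1)" "second_order (\<lambda>x. \<phi> x $ 2)"
  shows "second_order \<phi>"
proof -
  have "second_order (\<lambda>x. axis 1 (\<phi> x $ 1) + axis 2 (\<phi> x $ 2) :: complex^2)"
    by (intro second_order_add second_order_bounded_linear_compose[OF bounded_linear_axis] assms)
  then show ?thesis by (simp flip: vec2_eq_axis_add)
qed

lemma second_order_Pair:
  assumes "second_order \<phi>" "second_order \<psi>"
  shows "second_order (\<lambda>x. (\<phi> x, \<psi> x))"
proof -
  have "bounded_linear (\<lambda>x. (x, 0))" "bounded_linear (\<lambda>x. (0, x))"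
    by (auto intro!: bounded_linear_Pair bounded_linear_ident bounded_linear_zero)
  from second_order_add[OF second_order_bounded_linear_compose[OF this(1) assms(1)]
      second_order_bounded_linear_compose[OF this(2) assms(2)]]
  show ?thesis by simp
qed

section \<open>The Henon-type automorphism and its invariant cone\<close>

definition henon_inv :: "complex^2 \<Rightarrow> complex^2" where
  "henon_inv x = vector [2 * x $ 1 - (2 * x $ 2 - 4 * (x $ 1 * x $ 1)) * (2 * x $ 2 - 4 * (x $ 1 * x $ 1)),
                         2 * x $ 2 - 4 * (x $ 1 * x $ 1)]"

text \<open>Two shears followed by halving: z becomes z + w^2, then w gains the square of the new
  first coordinate. The first shear makes the first coordinate dominate where |w| is large; the
  second hands the dominance back to the second coordinate, so the cone can be invariant. Both added
  terms are quadratic, hence the derivative at 0 is half the identity.\<close>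

definition henon :: "complex^2 \<Rightarrow> complex^2" where
  "henon x = (1 / 2) *\<^sub>R vector [x $ 1 + (x $ 2)\<^sup>2, x $ 2 + (x $ 1 + (x $ 2)\<^sup>2)\<^sup>2]"

text \<open>This side of the inversion gives injectivity of \<open>henon_inv\<close> and turns F(2x)
  = \<open>henon_inv\<close> (F(x)) into F(x / 2) = \<open>henon\<close> (F(x)).\<close>

lemma henon_henon_inv: "henon (henon_inv x) = x"
  by (simp add: henon_def henon_inv_def vec_eq_iff forall_2 power2_eq_square)

lemma inj_henon_inv: "inj henon_inv"
  by (metis henon_henon_inv injI)

definition henon_inv_deriv :: "complex^2 \<Rightarrow> complex^2 \<Rightarrow> complex^2" where
  "henon_inv_deriv x v =
     vector [2 * v $ 1 - 2 * ((2 * x $ 2 - 4 * (x $ 1 * x $ 1)) * (2 * v $ 2 - 8 * (x $ 1 * v $ 1))),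
             2 * v $ 2 - 8 * (x $ 1 * v $ 1)]"

lemma henon_inv_has_derivative: "(henon_inv has_derivative henon_inv_deriv x) (at x)"
proof (rule has_derivative_vec_componentwise)
  fix i :: 2
  have "i = 1 \<or> i = 2" by (rule exhaust_2)
  then show "((\<lambda>x. henon_inv x $ i) has_derivative (\<lambda>v. henon_inv_deriv x v $ i)) (at x)"
    by (elim disjE; simp only: henon_inv_def henon_inv_deriv_def vector_2)
      (auto simp: algebra_simps
        intro!: derivative_eq_intros bounded_linear.has_derivative[OF bounded_linear_vec_nth])
qed

lemma henon_inv_deriv_linear: "Vector_Spaces.linear (*s) (*s) (henon_inv_deriv x)"
  by (simp add: linear_vec_iff henon_inv_deriv_def vec_eq_iff forall_2 algebra_simps)

text \<open>At the origin the tangent map is again doubling plus products of factors vanishing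
  there, so the closure rules apply and the constant is never computed.\<close>

lemma henon_tangent_doubles:
  obtains C where "doubles_to_second_order C (tangent_map henon_inv henon_inv_deriv)"
proof -
  let ?z = "\<lambda>p::(complex^2) \<times> (complex^2). fst p $ 1" and ?w = "\<lambda>p::(complex^2) \<times> (complex^2). fst p $ 2"
  let ?a = "\<lambda>p::(complex^2) \<times> (complex^2). snd p $ 1" and ?b = "\<lambda>p::(complex^2) \<times> (complex^2). snd p $ 2"
  have nth: "bounded_linear (\<lambda>p::(complex^2) \<times> (complex^2). fst p $ i)"
    "bounded_linear (\<lambda>p::(complex^2) \<times> (complex^2). snd p $ i)" for i
    by (auto intro: bounded_linear_compose[OF bounded_linear_vec_nth bounded_linear_fst]
        bounded_linear_compose[OF bounded_linear_vec_nth bounded_linear_snd])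
  note lin = lipschitz_vanishing_bounded_linear[OF nth(1)] lipschitz_vanishing_bounded_linear[OF nth(2)]
  have cmult: "second_order (\<lambda>x. c * \<phi> x)" if "second_order \<phi>"
    for c :: complex and \<phi> :: "(complex^2) \<times> (complex^2) \<Rightarrow> complex"
    by (rule second_order_bounded_linear_compose[OF bounded_linear_mult_right that])
  have dbl: "lipschitz_vanishing (\<lambda>p::(complex^2) \<times> (complex^2). 2 * fst p $ i)"
    "lipschitz_vanishing (\<lambda>p::(complex^2) \<times> (complex^2). 2 * snd p $ i)" for i
    by (auto intro!: lipschitz_vanishing_bounded_linear bounded_linear_compose[OF bounded_linear_mult_right] nth)
  have zz: "second_order (\<lambda>p. 4 * (?z p * ?z p))" and za: "second_order (\<lambda>p. 8 * (?z p * ?a p))"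
    by (intro cmult second_order_mult lin)+
  have q: "lipschitz_vanishing (\<lambda>p. 2 * ?w p - 4 * (?z p * ?z p))"
    and s: "lipschitz_vanishing (\<lambda>p. 2 * ?b p - 8 * (?z p * ?a p))"
    using zz[THEN lipschitz_vanishing_second_order] za[THEN lipschitz_vanishing_second_order]
    by (auto intro!: lipschitz_vanishing_diff dbl)
  have "second_order (\<lambda>p. (vector [(- 1) * ((2 * ?w p - 4 * (?z p * ?z p)) * (2 * ?w p - 4 * (?z p * ?z p))),
        (- 1) * (4 * (?z p * ?z p))] :: complex^2,
      vector [(- 2) * ((2 * ?w p - 4 * (?z p * ?z p)) * (2 * ?b p - 8 * (?z p * ?a p))),
        (- 1) * (8 * (?z p * ?a p))] :: complex^2))"
    unfolding second_order_def[of "\<lambda>p. vector (f p)" for f]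
    by (intro second_order_Pair second_order_vec2; simp only: vector_2)
      (intro cmult second_order_mult q s zz za)+
  also have "(\<lambda>p. (vector [(- 1) * ((2 * ?w p - 4 * (?z p * ?z p)) * (2 * ?w p - 4 * (?z p * ?z p))),
        (- 1) * (4 * (?z p * ?z p))] :: complex^2,
      vector [(- 2) * ((2 * ?w p - 4 * (?z p * ?z p)) * (2 * ?b p - 8 * (?z p * ?a p))),
        (- 1) * (8 * (?z p * ?a p))] :: complex^2))
      = (\<lambda>p. tangent_map henon_inv henon_inv_deriv p - 2 *\<^sub>R p)"
    by (auto simp: fun_eq_iff tangent_map_def henon_inv_def henon_inv_deriv_def vec_eq_iff forall_2
        prod_eq_iff scaleR_conv_of_real)
  finally obtain C where C: "C \<ge> 0" "\<And>x y. norm x \<le> 1 \<Longrightarrow> norm y \<le> 1 \<Longrightarrow>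
      norm (tangent_map henon_inv henon_inv_deriv x - 2 *\<^sub>R x
        - (tangent_map henon_inv henon_inv_deriv y - 2 *\<^sub>R y)) \<le> C * (norm x + norm y) * norm (x - y)"
    unfolding second_order_def by blast
  have "tangent_map henon_inv henon_inv_deriv 0 = 0"
    by (simp add: prod_eq_iff henon_inv_def henon_inv_deriv_def vec_eq_iff forall_2)
  then have "doubles_to_second_order C (tangent_map henon_inv henon_inv_deriv)"
    using C unfolding doubles_to_second_order_def by (simp add: algebra_simps)
  then show thesis by (rule that)
qed

text \<open>Once |w| is at least 10, the first shear gives |z'| at least 10|w| - |w| = 9|w|, hence
  at least 90. The second then gives at least 90|z'| - |w|, hence at least 89|z'|, leaving ample
  room for the halving.\<close>

lemma henon_escape_invariant:
  assumes "10 \<le> norm (x $ 2)" "norm (x $ 1) \<le> norm (x $ 2)"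
  shows "10 \<le> norm (henon x $ 2) \<and> norm (henon x $ 1) \<le> norm (henon x $ 2)"
proof -
  define z w where "z = x $ 1 + (x $ 2)\<^sup>2" and "w = x $ 2"
  have w: "10 \<le> norm w" using assms by (simp add: w_def)
  have "norm (w\<^sup>2) - norm (x $ 1) \<le> norm z"
    using norm_diff_ineq[of "w\<^sup>2" "x $ 1"] by (simp add: z_def w_def add.commute)
  moreover have "norm (w\<^sup>2) \<ge> 10 * norm w"
    using mult_right_mono[OF w, of "norm w"] by (simp add: norm_mult power2_eq_square)
  ultimately have z: "9 * norm w \<le> norm z"
    using assms by (simp add: w_def)
  then have "norm (z\<^sup>2) \<ge> 90 * norm z"
    using w mult_right_mono[of 90 "norm z" "norm z"] by (simp add: norm_mult power2_eq_square)
  then have "norm (w + z\<^sup>2) \<ge> 89 * norm z"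
    using norm_diff_ineq[of "z\<^sup>2" w] z w by (simp add: add.commute)
  then show ?thesis
    using z w by (simp add: henon_def flip: z_def) (simp add: w_def)
qed

text \<open>\<open>henon\<close> acts on the range of F as x to x / 2 acts on the source. A value in
  the cone would therefore force F(x / 2^n) into the cone for all n, although these values tend to
  F(0) = 0 and the cone keeps at distance 10 from the origin.\<close>

lemma fatou_bieberbach_avoiding_cone:
  obtains F :: "complex^2 \<Rightarrow> complex^2"
  where "entire_map F" "inj F"
    "\<And>x. \<not> (10 \<le> norm (F x $ 2) \<and> norm (F x $ 1) \<le> norm (F x $ 2))"
proof -
  obtain C where "doubles_to_second_order C (tangent_map henon_inv henon_inv_deriv)"
    by (rule henon_tangent_doubles)
  then obtain F :: "complex^2 \<Rightarrow> complex^2" where F: "entire_map F" "inj F" "F 0 = 0"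
    and eq: "\<And>x. F (2 *\<^sub>R x) = henon_inv (F x)"
    using poincare_map_exists[OF henon_inv_has_derivative henon_inv_deriv_linear _ inj_henon_inv] by blast
  have "False" if x: "10 \<le> norm (F x $ 2) \<and> norm (F x $ 1) \<le> norm (F x $ 2)" for x
  proof -
    have half: "F ((1 / 2) *\<^sub>R y) = henon (F y)" for y
      using eq[of "(1 / 2) *\<^sub>R y"] by (simp add: henon_henon_inv)
    have esc: "10 \<le> norm (F ((1 / 2) ^ n *\<^sub>R x) $ 2) \<and>
        norm (F ((1 / 2) ^ n *\<^sub>R x) $ 1) \<le> norm (F ((1 / 2) ^ n *\<^sub>R x) $ 2)" for n
    proof (induction n)
      case (Suc n)
      then show ?case
        using henon_escape_invariant half[of "(1 / 2) ^ n *\<^sub>R x"] by simp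
    qed (use x in simp)
    have "(\<lambda>n. (1 / 2) ^ n *\<^sub>R x) \<longlonglongrightarrow> 0 *\<^sub>R x"
      by (intro tendsto_scaleR LIMSEQ_power_zero tendsto_const) auto
    moreover have "isCont F 0"
      using F(1) has_derivative_continuous unfolding entire_map_def by blast
    ultimately have "(\<lambda>n. F ((1 / 2) ^ n *\<^sub>R x)) \<longlonglongrightarrow> F 0"
      using isCont_tendsto_compose by fastforce
    then have "(\<lambda>n. norm (F ((1 / 2) ^ n *\<^sub>R x) $ 2)) \<longlonglongrightarrow> norm (F 0 $ 2)"
      by (intro tendsto_norm tendsto_vec_nth)
    then have "10 \<le> norm (F 0 $ 2)"
      by (rule tendsto_lowerbound) (use esc in auto)
    then show False using F(3) by simp
  qed
  then show thesis using that F by blast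
qed

subsection \<open>Integral coordinates for discrete subgroups\<close>

text \<open>Translation carries the isolation of 0 to every point with the same radius; this is what
  makes bounded pieces of the group finite.\<close>

lemma discrete_subgroup_uniform:
  fixes L :: "'a::real_normed_vector set"
  assumes "0 \<in> L" "\<And>x y. x \<in> L \<Longrightarrow> y \<in> L \<Longrightarrow> x - y \<in> L" "discrete L"
  shows "uniform_discrete L"
proof -
  obtain e where e: "e > 0" "\<And>y. y \<in> L \<Longrightarrow> dist 0 y < e \<Longrightarrow> y = 0"
    using discreteD[OF assms(3,1)] unfolding isolated_in_dist_Ex_iff by blast
  show ?thesis
  proof (rule uniformI1[OF e(1)])
    fix x y
    assume "x \<in> L" "y \<in> L" "dist x y < e"
    then show "x = y"
      using e(2)[of "x - y"] assms(2) by (simp add: dist_norm norm_minus_commute)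
  qed
qed

text \<open>A pigeonhole argument. \<open>B\<close> is only a maximal independent subset, not a
  basis over the integers, so coordinates are merely rational; but multiples of x reduced modulo
  \<open>B\<close> fall into a bounded, hence finite, part of \<open>L\<close>, and a coincidence
  among them bounds the denominators uniformly.\<close>

lemma discrete_subgroup_commensurable:
  fixes L :: "'a::euclidean_space set"
  assumes L0: "0 \<in> L" and add: "\<And>x y. x \<in> L \<Longrightarrow> y \<in> L \<Longrightarrow> x + y \<in> L"
    and neg: "\<And>x. x \<in> L \<Longrightarrow> - x \<in> L" and "discrete L"
    and B: "B \<subseteq> L" "independent B" "L \<subseteq> span B"
  obtains K :: nat where "K > 0" "\<And>x b. x \<in> L \<Longrightarrow> b \<in> B \<Longrightarrow> real K * representation B x b \<in> \<int>"
proof -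
  have finB: "finite B"
    using B(2) by (rule independent_imp_finite)
  have diff: "x - y \<in> L" if "x \<in> L" "y \<in> L" for x y
    using add[OF that(1) neg[OF that(2)]] by simp
  have nat_mult: "real n *\<^sub>R x \<in> L" if "x \<in> L" for n x
    using that by (induction n) (auto simp: L0 add algebra_simps)
  have int_mult: "of_int k *\<^sub>R x \<in> L" if "x \<in> L" for k :: int and x
    using nat_mult[OF that, of "nat k"] neg[OF nat_mult[OF that, of "nat (- k)"]]
    by (cases "k \<ge> 0") auto
  have sum_mem: "sum f T \<in> L" if "\<And>b. b \<in> T \<Longrightarrow> f b \<in> L" for f :: "'a \<Rightarrow> 'a" and T
    using that by (induction T rule: infinite_finite_induct) (auto simp: L0 add)
  define M where "M = (\<Sum>b\<in>B. norm b)"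
  define D where "D = L \<inter> cball 0 M"
  have "uniform_discrete D"
    by (rule uniform_discrete_subset[OF discrete_subgroup_uniform[OF L0 _ \<open>discrete L\<close>]])
      (auto simp: D_def diff)
  moreover have "bounded D"
    by (simp add: D_def bounded_Int)
  ultimately have finD: "finite D"
    using uniform_discrete_finite_iff by blast
  define K where "K = card D"
  have "real (fact K) * representation B x b \<in> \<int>" if x: "x \<in> L" and b: "b \<in> B" for x b
  proof -
    define c where "c b = representation B x b" for b
    \<comment> \<open>\<open>y n\<close> is the n-th multiple of \<open>x\<close> reduced into the
      half-open parallelepiped spanned by \<open>B\<close>; it stays in \<open>L\<close> because
      only integer multiples of elements of \<open>B\<close> are subtracted.\<close>
    define y where "y n = (\<Sum>b\<in>B. frac (real n * c b) *\<^sub>R b)" for n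
    have x_eq: "x = (\<Sum>b\<in>B. c b *\<^sub>R b)"
      unfolding c_def using real_vector.sum_representation_eq[OF B(2) _ finB order_refl] B(3) x by auto
    have y_eq: "y n = real n *\<^sub>R x - (\<Sum>b\<in>B. of_int \<lfloor>real n * c b\<rfloor> *\<^sub>R b)" for n
      by (simp add: y_def x_eq frac_def scaleR_diff_left sum_subtractf scaleR_sum_right)
    have "y n \<in> D" for n
    proof -
      have "y n \<in> L"
        unfolding y_eq using B(1) x by (intro diff nat_mult sum_mem int_mult) auto
      moreover have "norm (y n) \<le> M"
        unfolding y_def M_def
        by (rule sum_norm_le) (simp add: abs_of_nonneg mult_left_le_one_le less_imp_le[OF frac_lt_1])
      ultimately show ?thesis by (simp add: D_def)
    qed
    then have "y ` {0..K} \<subseteq> D" by blast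
    then have "card (y ` {0..K}) \<le> K"
      unfolding K_def by (rule card_mono[OF finD])
    then have "\<not> inj_on y {0..K}"
      using card_image[of y "{0..K}"] by auto
    then obtain i j where ij: "i < j" "j \<le> K" "y i = y j"
      unfolding inj_on_def by (metis atLeastAtMost_iff linorder_neqE_nat)
    have "(\<Sum>b\<in>B. (frac (real j * c b) - frac (real i * c b)) *\<^sub>R b) = 0"
      using ij(3) by (simp add: y_def scaleR_diff_left sum_subtractf)
    then have "frac (real j * c b) - frac (real i * c b) = 0"
      by (rule real_vector.independentD[OF B(2) finB order_refl _ b])
    then have "real (j - i) * c b = of_int (\<lfloor>real j * c b\<rfloor> - \<lfloor>real i * c b\<rfloor>)"
      using ij(1) by (simp add: frac_def of_nat_diff algebra_simps)
    then have int: "real (j - i) * c b \<in> \<int>"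
      by (metis Ints_of_int)
    \<comment> \<open>\<open>i\<close> and \<open>j\<close> depend on \<open>x\<close>, but their
      difference is between 1 and \<open>K\<close>, so the factorial is a common denominator for all
      \<open>x\<close> and \<open>b\<close>.\<close>
    have "j - i dvd fact K"
      using ij by (intro dvd_fact) auto
    then obtain l where "fact K = (j - i) * l" ..
    then have "real (fact K) = real (j - i) * real l"
      by (simp only: of_nat_mult)
    then have eq: "real (fact K) * c b = real l * (real (j - i) * c b)"
      by (simp only: mult_ac)
    have "real (fact K) * c b \<in> \<int>"
      unfolding eq by (rule Ints_mult[OF Ints_of_nat int])
    then show ?thesis
      by (simp only: c_def)
  qed
  then show thesis
    using that[of "fact K"] by simp
qed

text \<open>The coordinates for a basis of the whole space that extends \<open>B\<close>, multiplied
  by the common denominator. Those outside \<open>B\<close> vanish on the group, so every rank is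
  treated alike and the functionals still separate points.\<close>

lemma discrete_subgroup_integral_functionals:
  fixes L :: "'a::euclidean_space set"
  assumes "0 \<in> L" "\<And>x y. x \<in> L \<Longrightarrow> y \<in> L \<Longrightarrow> x + y \<in> L" "\<And>x. x \<in> L \<Longrightarrow> - x \<in> L" "discrete L"
  obtains \<Xi> :: "('a \<Rightarrow> real) set"
  where "\<And>\<xi>. \<xi> \<in> \<Xi> \<Longrightarrow> linear \<xi>" "\<And>\<xi> x. \<xi> \<in> \<Xi> \<Longrightarrow> x \<in> L \<Longrightarrow> \<xi> x \<in> \<int>"
    "\<And>x. (\<And>\<xi>. \<xi> \<in> \<Xi> \<Longrightarrow> \<xi> x = 0) \<Longrightarrow> x = 0"
proof -
  obtain B where B: "B \<subseteq> L" "independent B" "L \<subseteq> span B"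
    by (rule maximal_independent_subset)
  obtain K where K: "K > 0" "\<And>x b. x \<in> L \<Longrightarrow> b \<in> B \<Longrightarrow> real K * representation B x b \<in> \<int>"
    using discrete_subgroup_commensurable[OF assms B] by blast
  define E where "E = extend_basis B"
  have E: "B \<subseteq> E" "independent E" "span E = UNIV"
    using extend_basis_superset[OF B(2)] independent_extend_basis[OF B(2)] span_extend_basis[OF B(2)]
    by (simp_all add: E_def)
  have finE: "finite E"
    using E(2) by (rule independent_imp_finite)
  show thesis
  proof (rule that[of "(\<lambda>b x. real K * representation E x b) ` E"])
    fix \<xi> assume \<xi>: "\<xi> \<in> (\<lambda>b x. real K * representation E x b) ` E"
    then obtain b where b: "b \<in> E" "\<xi> = (\<lambda>x. real K * representation E x b)"
      by blast
    show "linear \<xi>"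
      unfolding b(2)
      by (rule linearI)
        (simp_all add: real_vector.representation_add real_vector.representation_scale E algebra_simps)
    show "\<xi> x \<in> \<int>" if x: "x \<in> L" for x
    proof -
      have "representation E x = representation B x"
        using real_vector.representation_extend[OF E(2) _ E(1)] B(3) x by blast
      then show ?thesis
        using K(2)[OF x, of b] by (metis Ints_0 b(2) mult_zero_right real_vector.representation_ne_zero)
    qed
  next
    fix x
    assume 0: "\<And>\<xi>. \<xi> \<in> (\<lambda>b x. real K * representation E x b) ` E \<Longrightarrow> \<xi> x = 0"
    have "representation E x b = 0" if "b \<in> E" for b
      using 0[OF imageI[OF that]] K(1) by simp
    moreover have "(\<Sum>b\<in>E. representation E x b *\<^sub>R b) = x"
      using real_vector.sum_representation_eq[OF E(2) _ finE order_refl] E(3) by simp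
    ultimately show "x = 0"
      by simp
  qed
qed

text \<open>A real functional \<^term>\<open>\<xi>\<close> is the imaginary part of the complex linear functional
  \<^term>\<open>\<lambda>x. Complex (\<xi> (\<i> *s x)) (\<xi> x)\<close>.\<close>

lemma lattice_coordinates:
  assumes "is_lattice L"
  obtains a b c d :: complex
  where "a * d - b * c \<noteq> 0"
    "\<And>x. x \<in> L \<Longrightarrow> Im (a * x $ 1 + b * x $ 2) \<in> \<int>"
    "\<And>x. x \<in> L \<Longrightarrow> Im (c * x $ 1 + d * x $ 2) \<in> \<int>"
proof -
  obtain \<Xi> :: "(complex^2 \<Rightarrow> real) set"
    where lin: "\<And>\<xi>. \<xi> \<in> \<Xi> \<Longrightarrow> linear \<xi>" and int: "\<And>\<xi> x. \<xi> \<in> \<Xi> \<Longrightarrow> x \<in> L \<Longrightarrow> \<xi> x \<in> \<int>"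
      and sep: "\<And>x. (\<And>\<xi>. \<xi> \<in> \<Xi> \<Longrightarrow> \<xi> x = 0) \<Longrightarrow> x = 0"
    using discrete_subgroup_integral_functionals[of L] assms unfolding is_lattice_def by blast
  define \<alpha> \<beta> where "\<alpha> \<xi> = Complex (\<xi> (axis 1 \<i>)) (\<xi> (axis 1 1))"
    and "\<beta> \<xi> = Complex (\<xi> (axis 2 \<i>)) (\<xi> (axis 2 1))" for \<xi> :: "complex^2 \<Rightarrow> real"
  have Im: "Im (\<alpha> \<xi> * x $ 1 + \<beta> \<xi> * x $ 2) = \<xi> x" if "\<xi> \<in> \<Xi>" for \<xi> and x :: "complex^2"
  proof -
    have "x = Re (x $ 1) *\<^sub>R axis 1 1 + Im (x $ 1) *\<^sub>R axis 1 \<i> + Re (x $ 2) *\<^sub>R axis 2 1 + Im (x $ 2) *\<^sub>R axis 2 \<i>"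
      by (simp add: vec_eq_iff forall_2 axis_def complex_eq_iff)
    from arg_cong[OF this, of \<xi>] have "\<xi> x = Re (x $ 1) * \<xi> (axis 1 1) + Im (x $ 1) * \<xi> (axis 1 \<i>)
        + Re (x $ 2) * \<xi> (axis 2 1) + Im (x $ 2) * \<xi> (axis 2 \<i>)"
      by (simp only: linear_add[OF lin[OF that]] linear_scale[OF lin[OF that]] real_scaleR_def)
    then show ?thesis
      by (simp add: \<alpha>_def \<beta>_def)
  qed
  \<comment> \<open>Two of the complexified functionals must be independent over the complex
    numbers. If all determinants vanished, the vector (-\<open>\<beta> \<xi>\<close>,
    \<open>\<alpha> \<xi>\<close>) would be killed by every functional and so be 0; then all
    functionals would be 0, and they could not separate points.\<close>
  have "\<exists>\<xi>\<in>\<Xi>. \<exists>\<eta>\<in>\<Xi>. \<alpha> \<xi> * \<beta> \<eta> - \<beta> \<xi> * \<alpha> \<eta> \<noteq> 0"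
  proof (rule ccontr)
    assume "\<not> ?thesis"
    then have degenerate: "\<alpha> \<xi> * \<beta> \<eta> - \<beta> \<xi> * \<alpha> \<eta> = 0" if "\<xi> \<in> \<Xi>" "\<eta> \<in> \<Xi>" for \<xi> \<eta>
      using that by blast
    have zero: "\<alpha> \<xi> = 0 \<and> \<beta> \<xi> = 0" if "\<xi> \<in> \<Xi>" for \<xi>
    proof -
      have "(vector [- \<beta> \<xi>, \<alpha> \<xi>] :: complex^2) = 0"
      proof (rule sep)
        fix \<eta> assume "\<eta> \<in> \<Xi>"
        moreover have "\<alpha> \<eta> * - \<beta> \<xi> + \<beta> \<eta> * \<alpha> \<xi> = 0"
          using degenerate[OF that \<open>\<eta> \<in> \<Xi>\<close>] by (simp add: algebra_simps)
        ultimately show "\<eta> (vector [- \<beta> \<xi>, \<alpha> \<xi>]) = 0"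
          using Im[of \<eta> "vector [- \<beta> \<xi>, \<alpha> \<xi>]"] by (metis vector_2 zero_complex.sel(2))
      qed
      then show ?thesis
        by (simp add: vec_eq_iff forall_2)
    qed
    have "(axis 1 1 :: complex^2) = 0"
    proof (rule sep)
      fix \<eta> assume "\<eta> \<in> \<Xi>"
      from Im[OF this, of "axis 1 1"] zero[OF this] show "\<eta> (axis 1 1) = 0"
        by simp
    qed
    then show False
      by (simp add: axis_eq_0_iff)
  qed
  then obtain \<xi> \<eta> where "\<xi> \<in> \<Xi>" "\<eta> \<in> \<Xi>" "\<alpha> \<xi> * \<beta> \<eta> - \<beta> \<xi> * \<alpha> \<eta> \<noteq> 0"
    by blast
  then show thesis
    using that[of "\<alpha> \<xi>" "\<beta> \<eta>" "\<beta> \<xi>" "\<alpha> \<eta>"] Im int by simp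
qed

text \<open>Finitely many cosets of the integers are countable, so some real lies outside all of
  them, and its distance to each coset is positive.\<close>

lemma exists_shift_away_from_integers:
  fixes \<beta> :: "'i \<Rightarrow> real"
  assumes "finite J"
  obtains \<gamma> d where "d > 0" "\<And>j k. j \<in> J \<Longrightarrow> k \<in> \<int> \<Longrightarrow> d \<le> \<bar>k + \<beta> j - \<gamma>\<bar>"
proof -
  have "countable (\<Union>j\<in>J. (\<lambda>k. k + \<beta> j) ` \<int>)"
    using assms by (intro countable_UN countable_image countable_int countable_finite)
  then obtain \<gamma> where \<gamma>: "\<gamma> \<notin> (\<Union>j\<in>J. (\<lambda>k. k + \<beta> j) ` \<int>)"
    using uncountable_UNIV_real by (metis UNIV_eq_I)
  have "\<exists>e>0. \<forall>k\<in>\<int>. e \<le> \<bar>k + \<beta> j - \<gamma>\<bar>" if j: "j \<in> J" for j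
  proof -
    define u where "u = \<gamma> - \<beta> j"
    have "u \<notin> \<int>"
    proof
      assume "u \<in> \<int>"
      then have "\<gamma> \<in> (\<lambda>k. k + \<beta> j) ` \<int>"
        by (intro image_eqI[of _ _ u]) (auto simp: u_def)
      then show False using \<gamma> j by blast
    qed
    \<comment> \<open>The minimum is the distance from \<open>u\<close> to the nearest
      integer.\<close>
    then have "0 < min (frac u) (1 - frac u)"
      by (simp add: frac_gt_0_iff frac_lt_1)
    moreover have "min (frac u) (1 - frac u) \<le> \<bar>k + \<beta> j - \<gamma>\<bar>" if "k \<in> \<int>" for k
    proof -
      obtain i where i: "k = of_int i" using \<open>k \<in> \<int>\<close> by (rule Ints_cases)
      show ?thesis
      proof (cases "i \<le> \<lfloor>u\<rfloor>")
        case True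
        then have "real_of_int i \<le> of_int \<lfloor>u\<rfloor>" by simp
        then show ?thesis by (simp add: i u_def frac_def)
      next
        case False
        then have "real_of_int i \<ge> of_int \<lfloor>u\<rfloor> + 1" by linarith
        then show ?thesis by (simp add: i u_def frac_def)
      qed
    qed
    ultimately show ?thesis by blast
  qed
  then obtain e where e: "\<And>j. j \<in> J \<Longrightarrow> e j > 0 \<and> (\<forall>k\<in>\<int>. e j \<le> \<bar>k + \<beta> j - \<gamma>\<bar>)"
    by metis
  show thesis
  \<comment> \<open>The inserted 1 keeps the minimum meaningful when \<open>J\<close> is
    empty.\<close>
  proof (rule that[of "Min (insert 1 (e ` J))" \<gamma>])
    show "Min (insert 1 (e ` J)) > 0"
      using assms e by (subst Min_gr_iff) auto
    show "Min (insert 1 (e ` J)) \<le> \<bar>k + \<beta> j - \<gamma>\<bar>" if "j \<in> J" "k \<in> \<int>" for j k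
    proof -
      have "Min (insert 1 (e ` J)) \<le> e j"
        using assms that by (intro Min_le) auto
      then show ?thesis
        using e[OF that(1)] that(2) by force
    qed
  qed
qed

subsection \<open>The overshear\<close>

definition entire_fun :: "(complex^'n \<Rightarrow> complex) \<Rightarrow> bool" where
  "entire_fun \<phi> \<longleftrightarrow> (\<forall>x. \<exists>D. Vector_Spaces.linear (*s) (*) D \<and> (\<phi> has_derivative D) (at x))"

lemma linear_fun_iff:
  fixes D :: "complex^'n \<Rightarrow> complex"
  shows "Vector_Spaces.linear (*s) (*) D \<longleftrightarrow>
    (\<forall>x y. D (x + y) = D x + D y) \<and> (\<forall>c x. D (c *s x) = c * D x)"
proof -
  have "vector_space ((*) :: complex \<Rightarrow> complex \<Rightarrow> complex)"
    by unfold_locales (auto simp: algebra_simps)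
  then show ?thesis
    by (simp add: Vector_Spaces.linear_iff vec.vector_space_axioms)
qed

lemma entire_map_componentwise:
  fixes F :: "complex^'n \<Rightarrow> complex^'m"
  assumes "\<And>i. entire_fun (\<lambda>x. F x $ i)"
  shows "entire_map F"
  unfolding entire_map_def
proof
  fix x
  have "\<exists>D. \<forall>i. Vector_Spaces.linear (*s) (*) (D i) \<and> ((\<lambda>x. F x $ i) has_derivative D i) (at x)"
    using assms unfolding entire_fun_def by (intro choice) blast
  then obtain D where D: "\<And>i. Vector_Spaces.linear (*s) (*) (D i)"
    "\<And>i. ((\<lambda>x. F x $ i) has_derivative D i) (at x)"
    by blast
  have "(F has_derivative (\<lambda>v. \<chi> i. D i v)) (at x)"
    by (rule has_derivative_vec_componentwise) (simp add: D(2))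
  moreover have "Vector_Spaces.linear (*s) (*s) (\<lambda>v. \<chi> i. D i v)"
    using D(1) by (simp add: linear_vec_iff linear_fun_iff vec_eq_iff)
  ultimately show "\<exists>D. Vector_Spaces.linear (*s) (*s) D \<and> (F has_derivative D) (at x)"
    by blast
qed

lemma entire_fun_const: "entire_fun (\<lambda>x. c)"
  unfolding entire_fun_def linear_fun_iff by (intro allI exI[of _ "\<lambda>v. 0"]) auto

lemma entire_fun_nth: "entire_fun (\<lambda>x. x $ i)"
  unfolding entire_fun_def linear_fun_iff
  by (intro allI exI[of _ "\<lambda>v. v $ i"])
    (auto intro!: bounded_linear_imp_has_derivative bounded_linear_vec_nth)

lemma entire_fun_add:
  assumes "entire_fun \<phi>" "entire_fun \<psi>"
  shows "entire_fun (\<lambda>x. \<phi> x + \<psi> x)"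
  unfolding entire_fun_def
proof
  fix x
  obtain D E where "Vector_Spaces.linear (*s) (*) D" "(\<phi> has_derivative D) (at x)"
    "Vector_Spaces.linear (*s) (*) E" "(\<psi> has_derivative E) (at x)"
    using assms unfolding entire_fun_def by blast
  then show "\<exists>D. Vector_Spaces.linear (*s) (*) D \<and> ((\<lambda>x. \<phi> x + \<psi> x) has_derivative D) (at x)"
    by (intro exI[of _ "\<lambda>v. D v + E v"]) (auto simp: linear_fun_iff algebra_simps intro!: derivative_intros)
qed

lemma entire_fun_mult:
  assumes "entire_fun \<phi>" "entire_fun \<psi>"
  shows "entire_fun (\<lambda>x. \<phi> x * \<psi> x)"
  unfolding entire_fun_def
proof
  fix x
  obtain D E where "Vector_Spaces.linear (*s) (*) D" "(\<phi> has_derivative D) (at x)"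
    "Vector_Spaces.linear (*s) (*) E" "(\<psi> has_derivative E) (at x)"
    using assms unfolding entire_fun_def by blast
  then show "\<exists>D. Vector_Spaces.linear (*s) (*) D \<and> ((\<lambda>x. \<phi> x * \<psi> x) has_derivative D) (at x)"
    by (intro exI[of _ "\<lambda>v. \<phi> x * E v + D v * \<psi> x"])
      (auto simp: linear_fun_iff algebra_simps intro!: derivative_eq_intros)
qed

lemma entire_fun_exp:
  assumes "entire_fun \<phi>"
  shows "entire_fun (\<lambda>x. exp (\<phi> x))"
  unfolding entire_fun_def
proof
  fix x
  obtain D where D: "Vector_Spaces.linear (*s) (*) D" "(\<phi> has_derivative D) (at x)"
    using assms unfolding entire_fun_def by blast
  have "((\<lambda>x. exp (\<phi> x)) has_derivative (\<lambda>v. exp (\<phi> x) * D v)) (at x)"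
    using has_derivative_compose[OF D(2) DERIV_exp[unfolded has_field_derivative_def]] .
  then show "\<exists>D. Vector_Spaces.linear (*s) (*) D \<and> ((\<lambda>x. exp (\<phi> x)) has_derivative D) (at x)"
    using D(1) by (intro exI[of _ "\<lambda>v. exp (\<phi> x) * D v"]) (auto simp: linear_fun_iff algebra_simps)
qed

text \<open>-u^2 + cosh(tu), spelled with products and exponentials only, so that the closure rules
  for \<open>entire_fun\<close> apply to it as it stands.\<close>

definition overshear_exponent :: "real \<Rightarrow> complex \<Rightarrow> complex" where
  "overshear_exponent t u = (- 1) * (u * u) + (1 / 2) * (exp (of_real t * u) + exp (of_real (- t) * u))"

text \<open>From cosh s at least 1 + s^2 / 4 and \<open>t \<ge> 6\<close>, the factor cosh(tx) is at
  least 1 + 9x^2. Halved by the cosine this still contributes 9/2 x^2, more than the 2x^2 needed to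
  turn y^2 - x^2 into x^2 + y^2.\<close>

lemma Re_overshear_exponent_ge:
  assumes t: "t \<ge> 6" and cos: "cos (t * Im u) \<ge> 1 / 2"
  shows "(cmod u)\<^sup>2 \<le> Re (overshear_exponent t u)"
proof -
  define x y where "x = Re u" and "y = Im u"
  have cosh: "1 + (t * x)\<^sup>2 / 4 \<le> (exp (t * x) + exp (- (t * x))) / 2"
  proof -
    have "2 + s\<^sup>2 / 2 \<le> exp s + exp (- s)" if "s \<ge> 0" for s :: real
      using exp_lower_Taylor_quadratic[OF that] exp_ge_add_one_self[of "- s"] by simp
    from this[of "\<bar>t * x\<bar>"] show ?thesis
      by (cases "t * x \<ge> 0") auto
  qed
  have "36 * x\<^sup>2 \<le> t\<^sup>2 * x\<^sup>2"
    using power_mono[OF t, of 2] by (intro mult_right_mono) auto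
  then have "1 + 9 * x\<^sup>2 \<le> (exp (t * x) + exp (- (t * x))) / 2"
    using cosh by (simp add: power_mult_distrib)
  then have "(1 + 9 * x\<^sup>2) * (1 / 2) \<le> (exp (t * x) + exp (- (t * x))) / 2 * cos (t * y)" (is "_ \<le> ?Q")
    using cos by (intro mult_mono) (auto simp: y_def)
  then have "1 / 2 + 9 / 2 * x\<^sup>2 \<le> ?Q"
    by (simp add: algebra_simps)
  moreover have "Re (overshear_exponent t u) = y\<^sup>2 - x\<^sup>2 + ?Q"
    by (simp add: overshear_exponent_def Re_exp x_def y_def power2_eq_square algebra_simps)
  moreover have "(cmod u)\<^sup>2 = x\<^sup>2 + y\<^sup>2"
    by (simp add: cmod_power2 x_def y_def)
  ultimately show ?thesis
    using zero_le_power2[of x] by linarith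
qed

text \<open>Dirichlet's theorem brings all \<open>N * \<alpha> j\<close> within 1/16 of integers. A
  further deviation of 1/16 leaves \<open>N * y\<close> within 1/8 of an integer, an angle of at
  most pi/4, and the cosine is at least 1/2 up to pi/3. The tolerance on \<open>y\<close> is scaled
  by \<open>N\<close> because it is chosen after \<open>N\<close>.\<close>

lemma simultaneous_cos_ge_half:
  fixes \<alpha> :: "nat \<Rightarrow> real"
  obtains N :: nat where "N > 0"
    "\<And>j k y. j \<in> {1..m} \<Longrightarrow> k \<in> \<int> \<Longrightarrow> real N * \<bar>y - (k + \<alpha> j)\<bar> \<le> 1 / 16 \<Longrightarrow> cos (2 * pi * N * y) \<ge> 1 / 2"
proof -
  \<comment> \<open>The approximation theorem counts from 0 and the translates from 1, hence
    \<open>Suc i\<close> here and \<open>j - 1\<close> below.\<close>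
  obtain q p where q: "0 < q" and p: "\<And>i. i < m \<Longrightarrow> \<bar>of_int q * \<alpha> (Suc i) - of_int (p i)\<bar> < 1 / real 16"
    by (rule Dirichlet_approx_simult[of 16 m "\<lambda>i. \<alpha> (Suc i)"]) auto
  show thesis
  proof (rule that[of "nat q"])
    show "nat q > 0" using q by simp
    fix j k y
    assume j: "j \<in> {1..m}" and k: "k \<in> \<int>" and y: "real (nat q) * \<bar>y - (k + \<alpha> j)\<bar> \<le> 1 / 16"
    obtain k' where k': "k = of_int k'" using k by (rule Ints_cases)
    define P where "P = p (j - 1)"
    have "j - 1 < m"
      using j by auto
    then have P: "\<bar>of_int q * \<alpha> j - of_int P\<bar> < 1 / 16"
      using p[of "j - 1"] j by (simp add: P_def)
    define s where "s = of_int q * y - of_int (q * k' + P)"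
    have "s = of_int q * (y - (k + \<alpha> j)) + (of_int q * \<alpha> j - of_int P)"
      by (simp add: s_def k' algebra_simps)
    moreover have "\<bar>of_int q * (y - (k + \<alpha> j))\<bar> \<le> 1 / 16"
      using y q by (simp add: abs_mult)
    ultimately have s: "\<bar>s\<bar> \<le> 1 / 8"
      using P by linarith
    have "2 * pi * real (nat q) * y = 2 * pi * s + 2 * pi * of_int (q * k' + P)"
      using q by (simp add: s_def algebra_simps)
    then have "cos (2 * pi * real (nat q) * y) = cos (2 * pi * s)"
      by (simp only: cos_add cos_int_2pin sin_int_2pin)
    also have "\<dots> = cos (2 * pi * \<bar>s\<bar>)"
      by (cases "s \<ge> 0") auto
    also have "\<dots> \<ge> cos (pi / 3)"
      using s by (intro cos_monotone_0_pi_le) (auto simp: field_simps)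
    finally show "cos (2 * pi * real (nat q) * y) \<ge> 1 / 2"
      by (simp add: cos_60)
  qed
qed

text \<open>The constant \<open>20 / d\<close> lifts the linear factor to modulus at least 20, and
  the exponential factor has modulus at least 1 + |z|^2. The product is at least 20 (1 + |z|^2),
  which exceeds both 10 and |z|.\<close>

lemma overshear_into_cone:
  assumes t: "t \<ge> 6" "cos (t * Im z) \<ge> 1 / 2" and d: "d > 0" "d \<le> cmod w"
  shows "10 \<le> cmod (of_real (20 / d) * w * exp (overshear_exponent t z)) \<and>
    cmod z \<le> cmod (of_real (20 / d) * w * exp (overshear_exponent t z))"
proof -
  have "1 + (cmod z)\<^sup>2 \<le> exp (Re (overshear_exponent t z))"
    using Re_overshear_exponent_ge[OF t] exp_ge_add_one_self[of "(cmod z)\<^sup>2"]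
    by (meson exp_le_cancel_iff order_trans)
  moreover have "20 \<le> 20 / d * cmod w"
    using d by (simp add: field_simps)
  ultimately have "20 * (1 + (cmod z)\<^sup>2) \<le> 20 / d * cmod w * exp (Re (overshear_exponent t z))"
    using d by (intro mult_mono) auto
  then have le: "20 * (1 + (cmod z)\<^sup>2) \<le> cmod (of_real (20 / d) * w * exp (overshear_exponent t z))"
    using d by (simp add: norm_mult norm_divide)
  have quadratic: "10 \<le> 20 * (1 + n\<^sup>2) \<and> n \<le> 20 * (1 + n\<^sup>2)" if "n \<ge> 0" for n :: real
    using zero_le_power2[of "n - 1"] zero_le_power2[of n] that by (simp add: power2_diff)
  show ?thesis
    using quadratic[OF norm_ge_zero] order_trans[OF _ le] by blast
qed

section \<open>Choice of the radius and composition of the maps\<close>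

theorem theorem6p1:
  fixes \<Lambda> \<Lambda>\<^sub>0 :: "(complex^2) set"
    and p :: "nat \<Rightarrow> complex^2"
    and m :: nat
    and \<Lambda>\<^sub>0\<^sub>r :: "real \<Rightarrow> (complex^2) set"
  assumes "is_lattice \<Lambda>"
    and "\<Lambda>\<^sub>0 = (\<Union>j\<in>{1..m}. (\<lambda>x. x + p j) ` \<Lambda>)"
    and "\<And>r. r > 0 \<Longrightarrow> \<Lambda>\<^sub>0\<^sub>r r = (\<Union>q\<in>\<Lambda>\<^sub>0. bidisk q r)"
  shows "\<exists>r>0. \<exists>F :: complex^2 \<Rightarrow> complex^2.
           entire_map F \<and> inj F \<and> range F \<subseteq> UNIV - \<Lambda>\<^sub>0\<^sub>r r"
proof -
  obtain a b c d :: complex where det: "a * d - b * c \<noteq> 0"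
    and int: "\<And>x. x \<in> \<Lambda> \<Longrightarrow> Im (a * x $ 1 + b * x $ 2) \<in> \<int>"
      "\<And>x. x \<in> \<Lambda> \<Longrightarrow> Im (c * x $ 1 + d * x $ 2) \<in> \<int>"
    by (rule lattice_coordinates[OF assms(1)]) (rule that)
  define \<zeta> \<omega> where "\<zeta> x = a * x $ 1 + b * x $ 2" and "\<omega> x = c * x $ 1 + d * x $ 2" for x :: "complex^2"
  have add: "\<zeta> (x + y) = \<zeta> x + \<zeta> y" "\<omega> (x + y) = \<omega> x + \<omega> y" for x y
    by (simp_all add: \<zeta>_def \<omega>_def algebra_simps)
  obtain N :: nat where N: "N > 0"
    "\<And>j k y. j \<in> {1..m} \<Longrightarrow> k \<in> \<int> \<Longrightarrow> real N * \<bar>y - (k + Im (\<zeta> (p j)))\<bar> \<le> 1 / 16 \<Longrightarrow>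
       cos (2 * pi * N * y) \<ge> 1 / 2"
    by (rule simultaneous_cos_ge_half[of m "\<lambda>j. Im (\<zeta> (p j))"]) (rule that)
  obtain \<gamma> \<delta> where \<delta>: "\<delta> > 0" "\<And>j k. j \<in> {1..m} \<Longrightarrow> k \<in> \<int> \<Longrightarrow> \<delta> \<le> \<bar>k + Im (\<omega> (p j)) - \<gamma>\<bar>"
    by (rule exists_shift_away_from_integers[of "{1..m}" "\<lambda>j. Im (\<omega> (p j))", OF finite_atLeastAtMost])
      (rule that)
  define A where "A = cmod a + cmod b + cmod c + cmod d + 1"
  have A: "A > 0" by (simp add: A_def add_nonneg_pos)
  \<comment> \<open>The first bound is the tolerance that \<open>N\<close> leaves for the cosine;
    the second keeps half of the gap \<open>\<delta>\<close> around the free line.\<close>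
  define e where "e = min (1 / (16 * real N)) (\<delta> / 2)"
  have e: "e > 0" using N(1) \<delta>(1) by (simp add: e_def)
  \<comment> \<open>\<open>A\<close> bounds the coefficient sums of both coordinate functions, so
    within a bidisk of radius \<open>r\<close> they vary by at most \<open>e\<close> from the
    centre.\<close>
  define r where "r = e / A"
  have r: "r > 0" using e A by (simp add: r_def)
  define t where "t = 2 * pi * real N"
  have t: "t \<ge> 6"
    using mult_mono[of 3 pi 1 "real N"] pi_gt3 N(1) by (simp add: t_def)
  define w where "w x = \<omega> x - \<i> * of_real \<gamma>" for x
  define \<Phi> :: "complex^2 \<Rightarrow> complex^2" where
    "\<Phi> x = vector [\<zeta> x, of_real (20 / (\<delta> / 2)) * w x * exp (overshear_exponent t (\<zeta> x))]" for x
  \<comment> \<open>\<open>v\<close> recovers \<open>\<omega>\<close> from the image under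
    \<open>\<Phi>\<close>: \<open>\<delta> / 40\<close> is the reciprocal of
    \<open>20 / (\<delta> / 2)\<close>, the exponential is inverted, and the shift by
    \<open>\<gamma>\<close> is undone. Then \<open>\<Psi>\<close> solves the linear system by
    Cramer's rule.\<close>
  define v :: "complex^2 \<Rightarrow> complex" where
    "v y = of_real (\<delta> / 40) * y $ 2 * exp ((- 1) * overshear_exponent t (y $ 1)) + \<i> * of_real \<gamma>" for y
  define \<Psi> :: "complex^2 \<Rightarrow> complex^2" where
    "\<Psi> y = vector [(1 / (a * d - b * c)) * (d * y $ 1 + (- b) * v y), (1 / (a * d - b * c)) * ((- c) * y $ 1 + a * v y)]" for y
  \<comment> \<open>This identity makes \<open>\<Psi>\<close> injective and also gives avoidance: if
    \<open>\<Psi> (G x)\<close> were in a bidisk, its image \<open>G x\<close> under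
    \<open>\<Phi>\<close> would be in the cone.\<close>
  have \<Phi>\<Psi>: "\<Phi> (\<Psi> y) = y" for y
  proof -
    have "\<zeta> (\<Psi> y) = (1 / (a * d - b * c)) * ((a * d - b * c) * y $ 1)"
      unfolding \<zeta>_def \<Psi>_def vector_2 by algebra
    then have l: "\<zeta> (\<Psi> y) = y $ 1"
      using det by simp
    have "\<omega> (\<Psi> y) = (1 / (a * d - b * c)) * ((a * d - b * c) * v y)"
      unfolding \<omega>_def \<Psi>_def vector_2 by algebra
    then have k: "\<omega> (\<Psi> y) = v y"
      using det by simp
    have "exp ((- 1) * overshear_exponent t (y $ 1)) * exp (overshear_exponent t (y $ 1)) = 1"
      by (simp flip: exp_add)
    then show ?thesis
      using \<delta>(1) by (simp add: \<Phi>_def l w_def k v_def vec_eq_iff forall_2)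
  qed
  have v_entire: "entire_fun v"
    unfolding v_def[abs_def] overshear_exponent_def
    by (intro entire_fun_add entire_fun_mult entire_fun_exp entire_fun_nth entire_fun_const)
  have \<Psi>_entire: "entire_map \<Psi>"
  proof (rule entire_map_componentwise)
    fix i :: 2
    have "i = 1 \<or> i = 2" by (rule exhaust_2)
    then show "entire_fun (\<lambda>y. \<Psi> y $ i)"
      by (elim disjE; simp only: \<Psi>_def vector_2)
        (intro entire_fun_add entire_fun_mult v_entire entire_fun_nth entire_fun_const)+
  qed
  obtain G :: "complex^2 \<Rightarrow> complex^2" where G: "entire_map G" "inj G"
    and avoid: "\<And>x. \<not> (10 \<le> cmod (G x $ 2) \<and> cmod (G x $ 1) \<le> cmod (G x $ 2))"
    by (rule fatou_bieberbach_avoiding_cone) (rule that)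
  have cone: "10 \<le> cmod (\<Phi> x $ 2) \<and> cmod (\<Phi> x $ 1) \<le> cmod (\<Phi> x $ 2)" if "x \<in> \<Lambda>\<^sub>0\<^sub>r r" for x
  proof -
    from that obtain j u where j: "j \<in> {1..m}" and u: "u \<in> \<Lambda>" and x: "x \<in> bidisk (u + p j) r"
      unfolding assms(3)[OF r] assms(2) by blast
    define q where "q = u + p j"
    have small: "cmod (f * (x $ 1 - q $ 1) + g * (x $ 2 - q $ 2)) \<le> e" if "cmod f + cmod g \<le> A" for f g
    proof -
      have "cmod (f * (x $ 1 - q $ 1) + g * (x $ 2 - q $ 2)) \<le> cmod f * r + cmod g * r"
        using x unfolding bidisk_def q_def
        by (intro norm_triangle_mono; simp add: norm_mult mult_left_mono less_imp_le)
      also have "\<dots> = (cmod f + cmod g) * r"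
        by (simp add: algebra_simps)
      also have "\<dots> \<le> A * r"
        using that r by (intro mult_right_mono) auto
      finally show ?thesis using A by (simp add: r_def)
    qed
    have "\<zeta> x - \<zeta> q = a * (x $ 1 - q $ 1) + b * (x $ 2 - q $ 2)"
      "\<omega> x - \<omega> q = c * (x $ 1 - q $ 1) + d * (x $ 2 - q $ 2)"
      by (simp_all add: \<zeta>_def \<omega>_def right_diff_distrib)
    moreover have "cmod a + cmod b \<le> A" "cmod c + cmod d \<le> A"
      by (simp_all add: A_def)
    ultimately have "cmod (\<zeta> x - \<zeta> q) \<le> e" "cmod (\<omega> x - \<omega> q) \<le> e"
      using small[of a b] small[of c d] by simp_all
    then have close: "\<bar>Im (\<zeta> x) - Im (\<zeta> q)\<bar> \<le> e" "\<bar>Im (\<omega> x) - Im (\<omega> q)\<bar> \<le> e"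
      using abs_Im_le_cmod[of "\<zeta> x - \<zeta> q"] abs_Im_le_cmod[of "\<omega> x - \<omega> q"] by auto
    have "real N * \<bar>Im (\<zeta> x) - Im (\<zeta> q)\<bar> \<le> real N * (1 / (16 * real N))"
      using close(1) by (intro mult_left_mono) (auto simp: e_def)
    then have cos: "cos (t * Im (\<zeta> x)) \<ge> 1 / 2"
      unfolding t_def using N(1) int(1)[OF u]
      by (intro N(2)[OF j, of "Im (\<zeta> u)"]) (auto simp: q_def add \<zeta>_def[symmetric])
    have "\<delta> \<le> \<bar>Im (\<omega> q) - \<gamma>\<bar>"
      using \<delta>(2)[OF j int(2)[OF u]] by (simp add: q_def add flip: \<omega>_def)
    moreover have "e \<le> \<delta> / 2"
      by (simp add: e_def)
    moreover have "Im (w x) = Im (\<omega> x) - \<gamma>"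
      by (simp add: w_def)
    ultimately have "\<delta> / 2 \<le> \<bar>Im (w x)\<bar>"
      using close(2) by linarith
    then have "\<delta> / 2 \<le> cmod (w x)"
      using abs_Im_le_cmod[of "w x"] by linarith
    then show ?thesis
      using overshear_into_cone[OF t cos, of "\<delta> / 2" "w x"] \<delta>(1) by (simp add: \<Phi>_def)
  qed
  have missed: "\<Psi> (G x) \<notin> \<Lambda>\<^sub>0\<^sub>r r" for x
    using cone[of "\<Psi> (G x)"] avoid[of x] unfolding \<Phi>\<Psi> by blast
  show ?thesis
  proof (intro exI[of _ r] exI[of _ "\<lambda>x. \<Psi> (G x)"] conjI r)
    show "entire_map (\<lambda>x. \<Psi> (G x))"
      using entire_map_compose[OF \<Psi>_entire G(1)] .
    show "inj (\<lambda>x. \<Psi> (G x))"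
    proof (rule injI)
      fix x y
      assume "\<Psi> (G x) = \<Psi> (G y)"
      then have "G x = G y"
        using \<Phi>\<Psi> by metis
      then show "x = y"
        using G(2) by (simp add: inj_eq)
    qed
    show "range (\<lambda>x. \<Psi> (G x)) \<subseteq> UNIV - \<Lambda>\<^sub>0\<^sub>r r"
      using missed by blast
  qed
qed

end
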